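(* There exist a compact subset $K\subset\mathbb C$ and a function $\phi\in A(K)$ such that $R(K)\ne A(K)$ but $A(K)=HP(\phi,K)$.
   Context: $C(K)$ is the Banach algebra of continuous complex functions on $K$ with the supremum norm. $P(K)$ and $R(K)$ are the closures in $C(K)$ of the polynomials in $z$ and of the rational functions with poles off $K$, respectively. $A(K)\subset C(K)$ is the algebra of functions in $C(K)$ that are analytic in the interior of $K$. For $\phi\in C(K)$, $HP(\phi,K)$ is the closure in $C(K)$ of $P(K)\phi+R(K)$. *)

theory Defs
  imports "HOL-Analysis.Analysis" "HOL-Computational_Algebra.Polynomial"
begin

text \<open>
  The elements of the metric space \<open>cfunspace (top_of_set K) euclidean_metric\<close> are the bounded
  continuous functions on \<open>K\<close> that take the value \<^term>\<open>undefined\<close> outside \<open>K\<close>, and its metric is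
  the supremum metric. Functions on \<open>K\<close> are therefore cut down to \<open>K\<close> with \<^const>\<open>restrict\<close>, and
  equality of elements means equality on \<open>K\<close>. Boundedness is automatic for compact \<open>K\<close>, the only
  case of interest.
\<close>

definition C_metric :: "complex set \<Rightarrow> (complex \<Rightarrow> complex) metric" where
  "C_metric K = cfunspace (top_of_set K) euclidean_metric"

definition C_alg :: "complex set \<Rightarrow> (complex \<Rightarrow> complex) set" where
  "C_alg K = mspace (C_metric K)"

definition C_closure :: "complex set \<Rightarrow> (complex \<Rightarrow> complex) set \<Rightarrow> (complex \<Rightarrow> complex) set" where
  "C_closure K S = mtopology_of (C_metric K) closure_of S"

definition P_alg :: "complex set \<Rightarrow> (complex \<Rightarrow> complex) set" where
  "P_alg K = C_closure K {restrict (poly p) K | p. True}"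

text \<open>
  A rational function has its poles off \<open>K\<close> iff its denominator in lowest terms has no zero on \<open>K\<close>,
  so the following quotients are exactly the restrictions of these functions.
\<close>

definition R_alg :: "complex set \<Rightarrow> (complex \<Rightarrow> complex) set" where
  "R_alg K = C_closure K
     {restrict (\<lambda>z. poly p z / poly q z) K | p q. q \<noteq> 0 \<and> (\<forall>z\<in>K. poly q z \<noteq> 0)}"

definition A_alg :: "complex set \<Rightarrow> (complex \<Rightarrow> complex) set" where
  "A_alg K = {f \<in> C_alg K. f analytic_on interior K}"

definition HP_space :: "(complex \<Rightarrow> complex) \<Rightarrow> complex set \<Rightarrow> (complex \<Rightarrow> complex) set" where
  "HP_space \<phi> K = C_closure K
     {restrict (\<lambda>z. p z * \<phi> z + r z) K | p r. p \<in> P_alg K \<and> r \<in> R_alg K}"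

lemma C_alg_iff:
  assumes "compact K"
  shows "f \<in> C_alg K \<longleftrightarrow> f \<in> extensional K \<and> continuous_on K f"
  using assms
  by (simp add: C_alg_def C_metric_def compactin_mspace_cfunspace compactin_subtopology
           del: mspace_cfunspace)

lemma C_closure_iff:
  assumes "compact K" "S \<subseteq> C_alg K"
  shows "f \<in> C_closure K S \<longleftrightarrow>
           f \<in> C_alg K \<and> (\<forall>e>0. \<exists>g\<in>S. \<forall>z\<in>K. cmod (g z - f z) < e)"
proof -
  interpret M: Metric_space "mspace (C_metric K)" "mdist (C_metric K)"
    by simp
  have eq: "f \<in> C_closure K S \<longleftrightarrow>
      f \<in> C_alg K \<and> (\<forall>e>0. \<exists>g\<in>S. g \<in> C_alg K \<and> mdist (C_metric K) f g < e)"
    by (auto simp: C_closure_def C_alg_def mtopology_of_def M.metric_closure_of)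
  have comp: "compactin (top_of_set K) (topspace (top_of_set K))"
    using assms by (simp add: compactin_subtopology)
  have le: "\<forall>z\<in>K. cmod (g z - f z) < e"
    if "f \<in> C_alg K" "g \<in> C_alg K" "mdist (C_metric K) f g < e" for g e
    using cfunspace_mdist_lt[OF comp, of f euclidean_metric g e] that
    by (auto simp: C_alg_def C_metric_def dist_norm norm_minus_commute simp del: mspace_cfunspace)
  have ge: "mdist (C_metric K) f g \<le> e"
    if "e \<ge> 0" "\<forall>z\<in>K. cmod (g z - f z) < e" for g e
    unfolding C_metric_def using that
    by (intro mdist_cfunspace_le) (auto simp: dist_norm norm_minus_commute intro: less_imp_le)
  have "(\<exists>g\<in>S. g \<in> C_alg K \<and> mdist (C_metric K) f g < e)"
    if *: "\<forall>e>0. \<exists>g\<in>S. \<forall>z\<in>K. cmod (g z - f z) < e" "e > 0" for e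
  proof -
    obtain g where g: "g \<in> S" "\<forall>z\<in>K. cmod (g z - f z) < e / 2"
      using *(1)[rule_format, of "e / 2"] *(2) by auto
    moreover have "mdist (C_metric K) f g < e"
      using ge[of "e / 2" g] g *(2) by simp
    ultimately show ?thesis using assms by blast
  qed
  then show ?thesis
    unfolding eq using le by blast
qed

end

theory Submission
  imports Defs "HOL-Complex_Analysis.Complex_Analysis"
    "HOL-Computational_Algebra.Fundamental_Theorem_Algebra"
begin

text \<open>
  A single function \<open>\<phi> z = u (Re z)\<close>, with \<open>u\<close> real and continuous, serves every compact subset \<open>K\<close> of
  the closed unit disc: for \<open>u\<close> generic in the sense of Baire, the functions \<open>p \<phi> + q\<close> with
  polynomials \<open>p\<close> and \<open>q\<close> are uniformly dense in \<open>C(K)\<close>. The density of the relevant open sets rests on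
  the following observation. If \<open>u\<close> is equal to a constant \<open>c\<close> on \<open>[a, b]\<close> and the polynomial \<open>s\<close> is
  close to \<open>0\<close> for \<open>Re z \<le> a\<close> and to \<open>1\<close> for \<open>Re z \<ge> b\<close>, then \<open>s (\<phi> - c)\<close> is close to the truncation of
  \<open>\<phi> - c\<close> to \<open>Re z > a\<close>. Hence, if \<open>u\<close> is a staircase with steep ramps and flat steps, each of its ramps
  is a limit of functions \<open>p \<phi> + q\<close>, and so is any other staircase with the same steps. In this way the
  powers of \<open>Re z\<close> are reached, and Stone--Weierstrass does the rest.

  Now let \<open>K\<close> be a Swiss cheese without interior points. Then \<open>A(K) = C(K)\<close>, which is
  \<open>HP(\<phi>, K)\<close>, but the complex conjugation is not in \<open>R(K)\<close>.
\<close>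

section \<open>Uniform limits of polynomials\<close>

definition poly_limit :: "complex set \<Rightarrow> (complex \<Rightarrow> complex) \<Rightarrow> bool" where
  "poly_limit X f \<longleftrightarrow> (\<forall>e>0. \<exists>p. \<forall>z\<in>X. cmod (f z - poly p z) < e)"

lemma poly_limit_poly: "poly_limit X (poly p)"
  unfolding poly_limit_def by (intro allI impI exI[of _ p]) simp

lemma poly_limit_const: "poly_limit X (\<lambda>z. c)"
  using poly_limit_poly[of X "[:c:]"] unfolding poly_limit_def by simp

lemma poly_limit_cong:
  assumes "poly_limit X f" "\<And>z. z \<in> X \<Longrightarrow> f z = g z"
  shows "poly_limit X g"
  using assms by (simp add: poly_limit_def)

lemma poly_limit_closed:
  assumes "\<And>e. e > 0 \<Longrightarrow> \<exists>g. poly_limit X g \<and> (\<forall>z\<in>X. cmod (f z - g z) < e)"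
  shows "poly_limit X f"
  unfolding poly_limit_def
proof (intro allI impI)
  fix e :: real assume "e > 0"
  then obtain g where g: "poly_limit X g" "\<forall>z\<in>X. cmod (f z - g z) < e / 2"
    using assms[of "e / 2"] by auto
  then obtain p where p: "\<forall>z\<in>X. cmod (g z - poly p z) < e / 2"
    using \<open>e > 0\<close> unfolding poly_limit_def by (meson half_gt_zero)
  have "cmod (f z - poly p z) < e" if "z \<in> X" for z
    using g(2) p that norm_triangle_ineq[of "f z - g z" "g z - poly p z"] by force
  then show "\<exists>p. \<forall>z\<in>X. cmod (f z - poly p z) < e" by blast
qed

lemma poly_limit_add:
  assumes "poly_limit X f" "poly_limit X g"
  shows "poly_limit X (\<lambda>z. f z + g z)"
  unfolding poly_limit_def
proof (intro allI impI)
  fix e :: real assume e: "e > 0"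
  obtain p q where p: "\<forall>z\<in>X. cmod (f z - poly p z) < e / 2"
      and q: "\<forall>z\<in>X. cmod (g z - poly q z) < e / 2"
    using assms e unfolding poly_limit_def by (meson half_gt_zero)
  have "cmod (f z + g z - poly (p + q) z) < e" if "z \<in> X" for z
    using p q that norm_triangle_ineq[of "f z - poly p z" "g z - poly q z"]
    by (force simp: algebra_simps)
  then show "\<exists>p. \<forall>z\<in>X. cmod (f z + g z - poly p z) < e" by blast
qed

lemma bounded_poly_image:
  assumes "compact X"
  obtains B where "B > 0" "\<And>z. z \<in> X \<Longrightarrow> cmod (poly p z) \<le> B"
proof -
  have "bounded (poly p ` X)"
    by (intro compact_imp_bounded compact_continuous_image continuous_intros assms)
  then show ?thesis
    using that by (auto simp: bounded_pos)
qed

lemma poly_limit_bounded: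
  assumes "compact X" "poly_limit X f"
  obtains B where "B > 0" "\<And>z. z \<in> X \<Longrightarrow> cmod (f z) \<le> B"
proof -
  obtain p where p: "\<forall>z\<in>X. cmod (f z - poly p z) < 1"
    using assms(2) unfolding poly_limit_def by (meson zero_less_one)
  obtain B where "B > 0" "\<And>z. z \<in> X \<Longrightarrow> cmod (poly p z) \<le> B"
    using bounded_poly_image[OF assms(1)] by blast
  then have "cmod (f z) \<le> B + 1" if "z \<in> X" for z
    using p that norm_triangle_ineq[of "f z - poly p z" "poly p z"] by force
  with \<open>B > 0\<close> that[of "B + 1"] show ?thesis by auto
qed

lemma poly_limit_mult:
  assumes X: "compact X" and f: "poly_limit X f" and g: "poly_limit X g"
  shows "poly_limit X (\<lambda>z. f z * g z)"
  unfolding poly_limit_def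
proof (intro allI impI)
  fix e :: real assume e: "e > 0"
  obtain B where B: "B > 0" "\<And>z. z \<in> X \<Longrightarrow> cmod (f z) \<le> B"
    using poly_limit_bounded[OF X f] by blast
  obtain q where q: "\<forall>z\<in>X. cmod (g z - poly q z) < e / 2 / B"
    using g e B(1) unfolding poly_limit_def by (meson divide_pos_pos half_gt_zero)
  obtain C where C: "C > 0" "\<And>z. z \<in> X \<Longrightarrow> cmod (poly q z) \<le> C"
    using bounded_poly_image[OF X] by blast
  obtain p where p: "\<forall>z\<in>X. cmod (f z - poly p z) < e / 2 / C"
    using f e C(1) unfolding poly_limit_def by (meson divide_pos_pos half_gt_zero)
  have "cmod (f z * g z - poly (p * q) z) < e" if z: "z \<in> X" for z
  proof -
    have "f z * g z - poly (p * q) z = f z * (g z - poly q z) + (f z - poly p z) * poly q z"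
      by (simp add: algebra_simps)
    moreover have "cmod (f z * (g z - poly q z)) \<le> B * cmod (g z - poly q z)"
      using B z by (auto simp: norm_mult intro: mult_right_mono)
    moreover have "B * cmod (g z - poly q z) < B * (e / 2 / B)"
      using q z B(1) by (intro mult_strict_left_mono) auto
    moreover have "cmod ((f z - poly p z) * poly q z) \<le> cmod (f z - poly p z) * C"
      using C z by (auto simp: norm_mult intro: mult_left_mono)
    moreover have "cmod (f z - poly p z) * C < e / 2 / C * C"
      using p z C(1) by (intro mult_strict_right_mono) auto
    ultimately show ?thesis
      using B(1) C(1) norm_triangle_ineq[of "f z * (g z - poly q z)" "(f z - poly p z) * poly q z"]
      by simp
  qed
  then show "\<exists>p. \<forall>z\<in>X. cmod (f z * g z - poly p z) < e" by blast
qed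

lemma poly_limit_power:
  assumes "compact X" "poly_limit X f"
  shows "poly_limit X (\<lambda>z. f z ^ n)"
  by (induction n) (use assms in \<open>auto intro: poly_limit_const poly_limit_mult\<close>)

lemma poly_limit_sum:
  assumes "\<And>i. i \<in> I \<Longrightarrow> poly_limit X (f i)"
  shows "poly_limit X (\<lambda>z. \<Sum>i\<in>I. f i z)"
  using assms
  by (induction I rule: infinite_finite_induct)
     (auto intro: poly_limit_const poly_limit_add)

section \<open>Geometric series and the moving of poles\<close>

text \<open>The partial sums of the geometric series in \<open>g\<close> are again limits of
  polynomials, and the remainder \<open>g z ^ n / (1 - g z)\<close> is at most
  \<open>\<theta> ^ n / (1 - \<theta>)\<close> on all of \<open>X\<close>.\<close>

lemma poly_limit_geometric:
  assumes X: "compact X" and g: "poly_limit X g"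
    and \<theta>: "\<theta> < 1" "\<And>z. z \<in> X \<Longrightarrow> cmod (g z) \<le> \<theta>"
  shows "poly_limit X (\<lambda>z. 1 / (1 - g z))"
proof (cases "X = {}")
  case True
  then show ?thesis by (simp add: poly_limit_def)
next
  case False
  \<comment> \<open>It takes a point of \<open>X\<close> to force \<theta> to be nonnegative; for
    empty \<open>X\<close> it may be negative.\<close>
  then have \<theta>0: "0 \<le> \<theta>" using \<theta>(2) norm_ge_zero order_trans by blast
  show ?thesis
  proof (rule poly_limit_closed)
    fix e :: real assume e: "e > 0"
    obtain n where n: "\<theta> ^ n < e * (1 - \<theta>)"
      using real_arch_pow_inv[of "e * (1 - \<theta>)" \<theta>] e \<theta>(1) by auto
    have "cmod (1 / (1 - g z) - (\<Sum>i<n. g z ^ i)) < e" if z: "z \<in> X" for z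
    proof -
      have lt: "cmod (g z) \<le> \<theta>" using \<theta>(2) z by blast
      then have ne: "1 - g z \<noteq> 0" using \<theta>(1) by auto
      have "(\<Sum>i<n. g z ^ i) = (1 - g z ^ n) / (1 - g z)"
        using ne by (subst sum_gp_strict) auto
      then have "1 / (1 - g z) - (\<Sum>i<n. g z ^ i) = g z ^ n / (1 - g z)"
        by (simp flip: diff_divide_distrib)
      then have "cmod (1 / (1 - g z) - (\<Sum>i<n. g z ^ i)) = cmod (g z) ^ n / cmod (1 - g z)"
        by (simp add: norm_divide norm_power)
      also have "\<dots> \<le> \<theta> ^ n / (1 - \<theta>)"
        using lt \<theta>(1) \<theta>0 norm_triangle_ineq2[of 1 "g z"]
        by (intro frac_le power_mono) auto
      also have "\<dots> < e" using n \<theta>(1) by (simp add: divide_less_eq)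
      finally show ?thesis .
    qed
    then show "\<exists>h. poly_limit X h \<and> (\<forall>z\<in>X. cmod (1 / (1 - g z) - h z) < e)"
      by (intro exI[of _ "\<lambda>z. \<Sum>i<n. g z ^ i"])
         (auto intro!: poly_limit_sum poly_limit_power X g)
  qed
qed

text \<open>Runge's pole pushing: \<open>1 / (z - \<mu>)\<close> is \<open>1 / (z - \<zeta>)\<close>
  times the sum of a geometric series in \<open>(\<mu> - \<zeta>) / (z - \<zeta>)\<close>, whose
  modulus is at most \<open>cmod (\<mu> - \<zeta>) / d < 1\<close> on \<open>X\<close>.\<close>

lemma poly_limit_pole_push:
  assumes X: "compact X" and l: "poly_limit X (\<lambda>z. 1 / (z - \<zeta>))"
    and d: "\<And>z. z \<in> X \<Longrightarrow> d \<le> cmod (z - \<zeta>)" "cmod (\<mu> - \<zeta>) < d"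
  shows "poly_limit X (\<lambda>z. 1 / (z - \<mu>))"
proof -
  have d0: "d > 0" using d(2) norm_ge_zero order_le_less_trans by blast
  have g: "poly_limit X (\<lambda>z. (\<mu> - \<zeta>) * (1 / (z - \<zeta>)))"
    by (intro poly_limit_mult X l poly_limit_const)
  have "cmod ((\<mu> - \<zeta>) * (1 / (z - \<zeta>))) \<le> cmod (\<mu> - \<zeta>) / d" if "z \<in> X" for z
    using d(1)[OF that] d0 by (auto simp: norm_mult norm_divide intro!: frac_le)
  then have "poly_limit X (\<lambda>z. 1 / (1 - (\<mu> - \<zeta>) * (1 / (z - \<zeta>))))"
    using d(2) d0 by (intro poly_limit_geometric[OF X g, of "cmod (\<mu> - \<zeta>) / d"]) auto
  then have "poly_limit X (\<lambda>z. 1 / (z - \<zeta>) * (1 / (1 - (\<mu> - \<zeta>) * (1 / (z - \<zeta>)))))"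
    by (intro poly_limit_mult X l)
  then show ?thesis
  proof (rule poly_limit_cong)
    fix z assume z: "z \<in> X"
    then have "z \<noteq> \<zeta>" using d(1)[OF z] d0 by auto
    moreover have "z \<noteq> \<mu>" using d(1)[OF z] d(2) by auto
    ultimately show "1 / (z - \<zeta>) * (1 / (1 - (\<mu> - \<zeta>) * (1 / (z - \<zeta>)))) = 1 / (z - \<mu>)"
      by (simp add: field_simps)
  qed
qed

text \<open>The starting point of the pushing: for a pole outside a disc around 0 that contains
  \<open>X\<close>, expand in powers of \<open>z / \<zeta>\<close>.\<close>

lemma poly_limit_pole_far:
  assumes X: "compact X" and R: "\<And>z. z \<in> X \<Longrightarrow> cmod z \<le> R" "R < cmod \<zeta>" "0 < R"
  shows "poly_limit X (\<lambda>z. 1 / (z - \<zeta>))"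
proof -
  have l: "cmod \<zeta> > 0" "\<zeta> \<noteq> 0" using R by auto
  have "poly_limit X (\<lambda>z. 1 / (1 - (1 / \<zeta>) * z))"
  proof (rule poly_limit_geometric[OF X])
    show "poly_limit X (\<lambda>z. (1 / \<zeta>) * z)"
      using poly_limit_poly[of X "[:0, 1 / \<zeta>:]"] by (rule poly_limit_cong) simp
    show "R / cmod \<zeta> < 1" using R(2) l by simp
    show "cmod (1 / \<zeta> * z) \<le> R / cmod \<zeta>" if "z \<in> X" for z
      using R(1)[OF that] l by (simp add: norm_mult norm_divide divide_right_mono)
  qed
  then have "poly_limit X (\<lambda>z. (- 1 / \<zeta>) * (1 / (1 - (1 / \<zeta>) * z)))"
    by (intro poly_limit_mult X poly_limit_const)
  then show ?thesis
  proof (rule poly_limit_cong)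
    fix z assume z: "z \<in> X"
    then have "z \<noteq> \<zeta>" using R(1)[OF z] R(2) by auto
    then show "(- 1 / \<zeta>) * (1 / (1 - (1 / \<zeta>) * z)) = 1 / (z - \<zeta>)"
      using l by (simp add: field_simps)
  qed
qed

text \<open>The vertical line through the pole keeps distance \<open>d\<close> from
  \<open>X\<close>, so a pole can descend along it in steps of \<open>d / 2\<close> from a height
  where \<open>poly_limit_pole_far\<close> applies.\<close>

lemma poly_limit_pole_on_line:
  assumes X: "compact X" and d: "d > 0" "\<And>z. z \<in> X \<Longrightarrow> d \<le> \<bar>Re z - m\<bar>"
    and \<zeta>: "Re \<zeta> = m"
  shows "poly_limit X (\<lambda>z. 1 / (z - \<zeta>))"
proof -
  obtain R where R: "R > 0" "\<And>z. z \<in> X \<Longrightarrow> cmod z \<le> R"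
    using compact_imp_bounded[OF X] by (auto simp: bounded_pos)
  define T where "T = \<bar>Im \<zeta>\<bar> + R + 1"
  \<comment> \<open>\<open>T\<close> exceeds \<open>R\<close>, so \<open>n = 0\<close> is the case
    of a far pole; each further \<open>n\<close> lowers the admissible height by one step
    \<open>d / 2\<close>.\<close>
  have step: "poly_limit X (\<lambda>z. 1 / (z - Complex m t))" if "t \<ge> T - real n * (d / 2)" for n t
    using that
  proof (induction n arbitrary: t)
    case 0
    have "R < cmod (Complex m t)"
      using 0 R(1) abs_Im_le_cmod[of "Complex m t"] unfolding T_def by auto
    then show ?case by (intro poly_limit_pole_far[OF X R(2)]) (use R in auto)
  next
    case (Suc n)
    show ?case
    proof (rule poly_limit_pole_push[OF X])
      show "poly_limit X (\<lambda>z. 1 / (z - Complex m (t + d / 2)))"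
        using Suc.prems by (intro Suc.IH) (simp add: field_simps)
      show "d \<le> cmod (z - Complex m (t + d / 2))" if "z \<in> X" for z
        using d(2)[OF that] abs_Re_le_cmod[of "z - Complex m (t + d / 2)"] by simp
      have "Complex m t - Complex m (t + d / 2) = - (\<i> * (d / 2))"
        by (simp add: complex_eq_iff)
      then show "cmod (Complex m t - Complex m (t + d / 2)) < d"
        using d(1) by (simp add: norm_mult)
    qed
  qed
  obtain n where "T - Im \<zeta> < real n * (d / 2)"
    using reals_Archimedean3[of "d / 2"] d(1) by (meson half_gt_zero)
  then have "poly_limit X (\<lambda>z. 1 / (z - Complex m (Im \<zeta>)))"
    by (intro step[of n]) (auto simp: algebra_simps)
  moreover have "Complex m (Im \<zeta>) = \<zeta>" using \<zeta> by (simp add: complex_eq_iff)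
  ultimately show ?thesis by simp
qed

text \<open>Induction on the degree: the fundamental theorem of algebra splits off one linear
  factor, and products of limits are limits.\<close>

lemma poly_limit_inverse_poly:
  assumes X: "compact X"
    and roots: "\<And>\<zeta>. poly q \<zeta> = 0 \<Longrightarrow> poly_limit X (\<lambda>z. 1 / (z - \<zeta>))"
    and "q \<noteq> 0"
  shows "poly_limit X (\<lambda>z. 1 / poly q z)"
  using roots \<open>q \<noteq> 0\<close>
proof (induction "degree q" arbitrary: q)
  case 0
  then obtain c where "q = [:c:]" by (metis degree_eq_zeroE)
  then show ?case by (simp add: poly_limit_const)
next
  case (Suc n)
  obtain \<zeta> where \<zeta>: "poly q \<zeta> = 0"
    using Fundamental_Theorem_Algebra.fundamental_theorem_of_algebra[of q] Suc.hyps(2)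
    by (auto simp: constant_degree)
  then obtain r where r: "q = [:-\<zeta>, 1:] * r" by (auto simp: poly_eq_0_iff_dvd elim: dvdE)
  have "r \<noteq> 0" using r Suc.prems by auto
  then have "degree q = Suc (degree r)" unfolding r by (subst degree_mult_eq) auto
  then have "poly_limit X (\<lambda>z. 1 / poly r z)"
    using Suc r \<open>r \<noteq> 0\<close> by auto
  then have "poly_limit X (\<lambda>z. 1 / (z - \<zeta>) * (1 / poly r z))"
    using Suc.prems(1)[OF \<zeta>] by (intro poly_limit_mult X)
  then show ?case by (simp add: r algebra_simps)
qed

section \<open>Polynomials close to a step function of the real part\<close>

text \<open>Dividing by \<open>v ^ M\<close> gives \<open>t / (1 + t)\<close> with
  \<open>t = (u / v) ^ M\<close>, and \<open>cmod t \<le> 1 / 2\<close> keeps the denominator at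
  least \<open>1 / 2\<close> in modulus.\<close>

lemma power_ratio_bound:
  fixes u v :: complex
  assumes "cmod u \<le> \<theta> * cmod v" "v \<noteq> 0" "0 \<le> \<theta>" "\<theta> ^ M \<le> 1 / 2"
  shows "cmod (u ^ M / (v ^ M + u ^ M)) \<le> 2 * \<theta> ^ M"
proof -
  define t where "t = (u / v) ^ M"
  have "cmod (u / v) \<le> \<theta>" using assms by (simp add: norm_divide divide_le_eq)
  then have t: "cmod t \<le> \<theta> ^ M" by (simp add: t_def norm_power power_mono)
  have "1 + t = (v ^ M + u ^ M) / v ^ M"
    using assms(2) by (simp add: t_def power_divide add_divide_distrib)
  then have "u ^ M / (v ^ M + u ^ M) = t / (1 + t)"
    using assms(2) by (simp add: t_def power_divide)
  then have "cmod (u ^ M / (v ^ M + u ^ M)) = cmod t / cmod (1 + t)"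
    by (simp add: norm_divide)
  also have "\<dots> \<le> \<theta> ^ M / (1 / 2)"
    using t assms(3,4) norm_triangle_ineq2[of 1 "- t"]
    by (intro frac_le) auto
  finally show ?thesis by simp
qed

text \<open>The squares differ by \<open>4 * Re w\<close>: the imaginary axis is the bisector of 1
  and -1.\<close>

lemma cmod_minus_one_less_iff: "cmod (w - 1) < cmod (w + 1) \<longleftrightarrow> Re w > 0"
proof -
  have "cmod (w - 1) < cmod (w + 1) \<longleftrightarrow> (cmod (w - 1))\<^sup>2 < (cmod (w + 1))\<^sup>2"
    by (simp add: power_mono_iff flip: not_le)
  then show ?thesis by (simp add: cmod_power2) (simp add: power2_eq_square algebra_simps)
qed

text \<open>The quotient of the moduli attains its maximum on \<open>X\<close>, and that maximum is
  below 1. This uniform factor makes high powers of the quotient decay uniformly.\<close>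

lemma compact_ratio_bound:
  fixes f g :: "complex \<Rightarrow> complex"
  assumes "compact X" "continuous_on X f" "continuous_on X g"
    "\<And>z. z \<in> X \<Longrightarrow> cmod (f z) < cmod (g z)"
  obtains \<theta> where "0 \<le> \<theta>" "\<theta> < 1" "\<And>z. z \<in> X \<Longrightarrow> cmod (f z) \<le> \<theta> * cmod (g z)"
proof (cases "X = {}")
  case True
  with that[of 0] show ?thesis by auto
next
  case False
  have ne: "\<And>z. z \<in> X \<Longrightarrow> cmod (g z) > 0"
    using assms(4) norm_ge_zero order_le_less_trans by blast
  then have "continuous_on X (\<lambda>z. cmod (f z) / cmod (g z))"
    by (intro continuous_intros assms) force
  then obtain w where w: "w \<in> X" "\<And>z. z \<in> X \<Longrightarrow> cmod (f z) / cmod (g z) \<le> cmod (f w) / cmod (g w)"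
    using continuous_attains_sup[OF assms(1) False] by blast
  show ?thesis
  proof (rule that[of "cmod (f w) / cmod (g w)"])
    show "cmod (f w) / cmod (g w) < 1" using assms(4)[OF w(1)] ne[OF w(1)] by simp
    show "cmod (f z) \<le> cmod (f w) / cmod (g w) * cmod (g z)" if "z \<in> X" for z
      using w(2)[OF that] ne[OF that] by (simp add: divide_le_eq)
  qed simp
qed

text \<open>
  With \<open>w = z - m\<close>, where \<open>m\<close> is the midpoint of \<open>a\<close> and \<open>b\<close>, the rational function
  \<open>(w + 1) ^ M / ((w + 1) ^ M + (w - 1) ^ M)\<close> tends to the required step function, and all its poles
  lie on the line \<open>Re z = m\<close>.
\<close>

lemma step_polynomial:
  fixes a b :: real
  assumes D: "compact D" and ab: "a < b" and e: "e > 0"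
  obtains s where "\<And>z. z \<in> D \<Longrightarrow> Re z \<le> a \<Longrightarrow> cmod (poly s z) < e"
    and "\<And>z. z \<in> D \<Longrightarrow> b \<le> Re z \<Longrightarrow> cmod (poly s z - 1) < e"
proof -
  define m where "m = (a + b) / 2"
  define L where "L = D \<inter> {z. Re z \<le> a}"
  define R where "R = D \<inter> {z. b \<le> Re z}"
  have cL: "compact L" and cR: "compact R"
    unfolding L_def R_def using D by (auto intro!: compact_Int_closed closed_halfspace_Re_le closed_halfspace_Re_ge)
  have cX: "compact (L \<union> R)" using cL cR by (rule compact_Un)
  obtain \<theta>1 where \<theta>1: "0 \<le> \<theta>1" "\<theta>1 < 1"
    "\<And>z. z \<in> R \<Longrightarrow> cmod (z - m - 1) \<le> \<theta>1 * cmod (z - m + 1)"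
  proof (rule compact_ratio_bound[OF cR, of "\<lambda>z. z - m - 1" "\<lambda>z. z - m + 1"])
    show "cmod (z - m - 1) < cmod (z - m + 1)" if "z \<in> R" for z
      using that ab by (subst cmod_minus_one_less_iff) (auto simp: R_def m_def field_simps)
  qed (auto intro!: continuous_intros)
  obtain \<theta>2 where \<theta>2: "0 \<le> \<theta>2" "\<theta>2 < 1"
    "\<And>z. z \<in> L \<Longrightarrow> cmod (z - m + 1) \<le> \<theta>2 * cmod (z - m - 1)"
  proof (rule compact_ratio_bound[OF cL, of "\<lambda>z. z - m + 1" "\<lambda>z. z - m - 1"])
    show "cmod (z - m + 1) < cmod (z - m - 1)" if "z \<in> L" for z
    proof -
      have "cmod (- (z - m) - 1) < cmod (- (z - m) + 1)"
        using that ab by (subst cmod_minus_one_less_iff) (auto simp: L_def m_def field_simps)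
      moreover have "- (z - m) - 1 = - (z - m + 1)" "- (z - m) + 1 = - (z - m - 1)" by simp_all
      ultimately show ?thesis by (simp only: norm_minus_cancel)
    qed
  qed (auto intro!: continuous_intros)
  define \<theta> where "\<theta> = max \<theta>1 \<theta>2"
  have \<theta>: "0 \<le> \<theta>" "\<theta> < 1" using \<theta>1 \<theta>2 by (auto simp: \<theta>_def)
  \<comment> \<open>The bound \<open>1 / 2\<close> is what \<open>power_ratio_bound\<close> asks
    for; the bound \<open>e / 4\<close> makes its conclusion \<open>2 * \<theta> ^ M\<close> less
    than \<open>e / 2\<close>, leaving \<open>e / 2\<close> for the approximation by
    \<open>s\<close>.\<close>
  obtain M where M: "\<theta> ^ M < min (e / 4) (1 / 2)"
    using real_arch_pow_inv[of "min (e / 4) (1 / 2)" \<theta>] e \<theta> by auto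
  define q :: "complex poly" where "q = [:1 - of_real m, 1:] ^ M + [:- 1 - of_real m, 1:] ^ M"
  have q: "poly q z = (z - m + 1) ^ M + (z - m - 1) ^ M" for z
    by (simp add: q_def algebra_simps)
  \<comment> \<open>A zero of \<open>q\<close> is equally far from \<open>m - 1\<close> and
    \<open>m + 1\<close>, hence on the bisector \<open>Re z = m\<close>. For \<open>M = 0\<close>
    there is no zero, as \<open>q\<close> is then the constant 2.\<close>
  have root: "Re \<zeta> = m" if "poly q \<zeta> = 0" for \<zeta> :: complex
  proof -
    have M0: "M > 0" using that q[of \<zeta>] by (cases M) auto
    have "(\<zeta> - m + 1) ^ M = - ((\<zeta> - m - 1) ^ M)"
      using that q[of \<zeta>] by (simp add: add_eq_0_iff)
    then have "cmod (\<zeta> - m + 1) ^ M = cmod (\<zeta> - m - 1) ^ M"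
      by (metis norm_minus_cancel norm_power)
    then have eq: "cmod (\<zeta> - m + 1) = cmod (\<zeta> - m - 1)"
      using M0 by (simp add: power_eq_iff_eq_base)
    then have "\<not> Re (\<zeta> - m) > 0"
      using cmod_minus_one_less_iff[of "\<zeta> - m"] by simp
    moreover have "- (\<zeta> - m) - 1 = - (\<zeta> - m + 1)" "- (\<zeta> - m) + 1 = - (\<zeta> - m - 1)" by simp_all
    then have "cmod (- (\<zeta> - m) - 1) = cmod (- (\<zeta> - m) + 1)"
      using eq by (simp only: norm_minus_cancel)
    then have "\<not> Re (- (\<zeta> - m)) > 0"
      using cmod_minus_one_less_iff[of "- (\<zeta> - m)"] by simp
    ultimately show ?thesis by simp
  qed
  have "q \<noteq> 0"
    using root[of "of_real (m + 1)"] by auto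
  then have "poly_limit (L \<union> R) (\<lambda>z. 1 / poly q z)"
  proof (intro poly_limit_inverse_poly cX)
    show "poly_limit (L \<union> R) (\<lambda>z. 1 / (z - \<zeta>))" if "poly q \<zeta> = 0" for \<zeta>
    proof (rule poly_limit_pole_on_line[OF cX _ _ root[OF that]])
      show "(b - a) / 2 > 0" using ab by simp
      show "(b - a) / 2 \<le> \<bar>Re z - m\<bar>" if "z \<in> L \<union> R" for z
        using that by (auto simp: L_def R_def m_def field_simps abs_if)
    qed
  qed
  then have "poly_limit (L \<union> R) (\<lambda>z. poly ([:1 - of_real m, 1:] ^ M) z * (1 / poly q z))"
    by (intro poly_limit_mult cX poly_limit_poly)
  then obtain s where s: "\<forall>z\<in>L \<union> R.
      cmod (poly ([:1 - of_real m, 1:] ^ M) z * (1 / poly q z) - poly s z) < e / 2"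
    using e unfolding poly_limit_def by (meson half_gt_zero)
  define h where "h = (\<lambda>z::complex. (z - m + 1) ^ M / ((z - m + 1) ^ M + (z - m - 1) ^ M))"
  have s': "cmod (h z - poly s z) < e / 2" if "z \<in> L \<union> R" for z
    using s[rule_format, OF that] by (simp add: h_def q algebra_simps)
  show ?thesis
  proof (rule that)
    fix z assume z: "z \<in> D" "Re z \<le> a"
    then have zL: "z \<in> L" by (simp add: L_def)
    have "z - m - 1 \<noteq> 0" using z ab by (auto simp: m_def complex_eq_iff field_simps)
    have "cmod (z - m + 1) \<le> \<theta> * cmod (z - m - 1)"
      using \<theta>2(3)[OF zL] by (rule order_trans) (auto simp: \<theta>_def intro: mult_right_mono)
    then have "cmod ((z - m + 1) ^ M / ((z - m - 1) ^ M + (z - m + 1) ^ M)) \<le> 2 * \<theta> ^ M"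
      using M \<theta> \<open>z - m - 1 \<noteq> 0\<close> by (intro power_ratio_bound) auto
    then have "cmod (h z) < e / 2"
      using M by (simp add: h_def add.commute)
    then show "cmod (poly s z) < e"
      using s'[of z] zL norm_triangle_ineq[of "poly s z - h z" "h z"]
      by (simp add: norm_minus_commute)
  next
    fix z assume z: "z \<in> D" "b \<le> Re z"
    then have zR: "z \<in> R" by (simp add: R_def)
    have ne: "z - m + 1 \<noteq> 0" using z ab by (auto simp: m_def complex_eq_iff field_simps)
    have "cmod (z - m - 1) \<le> \<theta> * cmod (z - m + 1)"
      using \<theta>1(3)[OF zR] by (rule order_trans) (auto simp: \<theta>_def intro: mult_right_mono)
    then have "cmod ((z - m - 1) ^ M / ((z - m + 1) ^ M + (z - m - 1) ^ M)) \<le> 2 * \<theta> ^ M"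
      using M \<theta> ne by (intro power_ratio_bound) auto
    moreover have "poly q z \<noteq> 0"
    proof
      assume "poly q z = 0"
      then show False using root[of z] z ab by (auto simp: m_def)
    qed
    then have "1 - h z = (z - m - 1) ^ M / ((z - m + 1) ^ M + (z - m - 1) ^ M)"
      by (simp add: h_def q field_simps)
    ultimately have "cmod (1 - h z) < e / 2" using M by simp
    then show "cmod (poly s z - 1) < e"
      using s'[of z] zR norm_triangle_ineq[of "poly s z - h z" "h z - 1"]
      by (simp add: norm_minus_commute)
  qed
qed

section \<open>A generic function of the real part\<close>

text \<open>Polynomials stand in for the elements of both \<open>P_alg\<close> and
  \<open>R_alg\<close>; on the Swiss cheese this already yields membership in
  \<open>HP_space\<close>.\<close>

definition hp_limit :: "complex set \<Rightarrow> (complex \<Rightarrow> complex) \<Rightarrow> (complex \<Rightarrow> complex) \<Rightarrow> bool" where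
  "hp_limit X \<phi> F \<longleftrightarrow> (\<forall>e>0. \<exists>p q. \<forall>z\<in>X. cmod (F z - (poly p z * \<phi> z + poly q z)) < e)"

lemma hp_limitD:
  assumes "hp_limit X \<phi> F" "e > 0"
  obtains p q where "\<And>z. z \<in> X \<Longrightarrow> cmod (F z - (poly p z * \<phi> z + poly q z)) < e"
  using assms unfolding hp_limit_def by blast

lemma hp_limit_poly: "hp_limit X \<phi> (poly q)"
  unfolding hp_limit_def by (intro allI impI exI[of _ 0] exI[of _ q]) simp

lemma hp_limit_const: "hp_limit X \<phi> (\<lambda>z. c)"
  using hp_limit_poly[of X \<phi> "[:c:]"] unfolding hp_limit_def by simp

lemma hp_limit_self: "hp_limit X \<phi> \<phi>"
  unfolding hp_limit_def by (intro allI impI exI[of _ 1] exI[of _ 0]) simp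

lemma hp_limit_cong:
  assumes "hp_limit X \<phi> F" "\<And>z. z \<in> X \<Longrightarrow> F z = G z"
  shows "hp_limit X \<phi> G"
  using assms by (simp add: hp_limit_def)

lemma hp_limit_closed:
  assumes "\<And>e. e > 0 \<Longrightarrow> \<exists>G. hp_limit X \<phi> G \<and> (\<forall>z\<in>X. cmod (F z - G z) < e)"
  shows "hp_limit X \<phi> F"
  unfolding hp_limit_def
proof (intro allI impI)
  fix e :: real assume "e > 0"
  then obtain G where G: "hp_limit X \<phi> G" "\<forall>z\<in>X. cmod (F z - G z) < e / 2"
    using assms[of "e / 2"] by auto
  then obtain p q where p: "\<And>z. z \<in> X \<Longrightarrow> cmod (G z - (poly p z * \<phi> z + poly q z)) < e / 2"
    using \<open>e > 0\<close> hp_limitD[of X \<phi> G "e / 2"] by auto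
  have "cmod (F z - (poly p z * \<phi> z + poly q z)) < e" if "z \<in> X" for z
    using norm_diff_triangle_less[OF bspec[OF G(2) that] p[OF that]] by simp
  then show "\<exists>p q. \<forall>z\<in>X. cmod (F z - (poly p z * \<phi> z + poly q z)) < e" by blast
qed

lemma hp_limit_add:
  assumes "hp_limit X \<phi> F" "hp_limit X \<phi> G"
  shows "hp_limit X \<phi> (\<lambda>z. F z + G z)"
  unfolding hp_limit_def
proof (intro allI impI)
  fix e :: real assume e: "e > 0"
  obtain p q where p: "\<And>z. z \<in> X \<Longrightarrow> cmod (F z - (poly p z * \<phi> z + poly q z)) < e / 2"
    using e hp_limitD[OF assms(1), of "e / 2"] by auto
  obtain r s where r: "\<And>z. z \<in> X \<Longrightarrow> cmod (G z - (poly r z * \<phi> z + poly s z)) < e / 2"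
    using e hp_limitD[OF assms(2), of "e / 2"] by auto
  have "cmod (F z + G z - (poly (p + r) z * \<phi> z + poly (q + s) z)) < e" if "z \<in> X" for z
  proof -
    have "F z + G z - (poly (p + r) z * \<phi> z + poly (q + s) z) =
        (F z - (poly p z * \<phi> z + poly q z)) + (G z - (poly r z * \<phi> z + poly s z))"
      by (simp add: algebra_simps)
    then show ?thesis
      using p[OF that] r[OF that] by (metis add_strict_mono field_sum_of_halves norm_triangle_lt)
  qed
  then show "\<exists>p q. \<forall>z\<in>X. cmod (F z + G z - (poly p z * \<phi> z + poly q z)) < e" by blast
qed

text \<open>Products with polynomials are the only ones at hand, since a product of two such limits
  would bring in the square of \<phi>. This is why every power of \<open>Re z\<close> is
  approximated later, and not just \<open>Re z\<close> itself.\<close>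

lemma hp_limit_poly_mult:
  assumes X: "compact X" and F: "hp_limit X \<phi> F"
  shows "hp_limit X \<phi> (\<lambda>z. poly r z * F z)"
  unfolding hp_limit_def
proof (intro allI impI)
  fix e :: real assume e: "e > 0"
  obtain B where B: "B > 0" "\<And>z. z \<in> X \<Longrightarrow> cmod (poly r z) \<le> B"
    using bounded_poly_image[OF X] by blast
  obtain p q where p: "\<And>z. z \<in> X \<Longrightarrow> cmod (F z - (poly p z * \<phi> z + poly q z)) < e / B"
    using e B hp_limitD[OF F, of "e / B"] by auto
  have "cmod (poly r z * F z - (poly (r * p) z * \<phi> z + poly (r * q) z)) < e" if "z \<in> X" for z
  proof -
    have "poly r z * F z - (poly (r * p) z * \<phi> z + poly (r * q) z) =
        poly r z * (F z - (poly p z * \<phi> z + poly q z))"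
      by (simp add: algebra_simps)
    then have "cmod (poly r z * F z - (poly (r * p) z * \<phi> z + poly (r * q) z)) \<le>
        B * cmod (F z - (poly p z * \<phi> z + poly q z))"
      using B(2)[OF that] by (simp add: norm_mult mult_right_mono)
    also have "\<dots> < B * (e / B)"
      using p[OF that] B(1) by (intro mult_strict_left_mono) auto
    finally show ?thesis using B(1) by simp
  qed
  then show "\<exists>p q. \<forall>z\<in>X. cmod (poly r z * F z - (poly p z * \<phi> z + poly q z)) < e" by blast
qed

lemma hp_limit_cmult:
  assumes "compact X" "hp_limit X \<phi> F"
  shows "hp_limit X \<phi> (\<lambda>z. c * F z)"
  using hp_limit_poly_mult[OF assms, of "[:c:]"] by simp

lemma hp_limit_sum:
  assumes "\<And>i. i \<in> I \<Longrightarrow> hp_limit X \<phi> (F i)"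
  shows "hp_limit X \<phi> (\<lambda>z. \<Sum>i\<in>I. F i z)"
  using assms
proof (induction I rule: infinite_finite_induct)
  case (insert i I)
  then show ?case using hp_limit_add[of X \<phi> "F i" "\<lambda>z. \<Sum>i\<in>I. F i z"] by auto
qed (simp_all add: hp_limit_const)

text \<open>\<open>p * \<phi> + q\<close> equals \<open>p * \<psi> + (q - c * p)\<close>. A
  staircase that starts at 0 can thus be raised to a prescribed initial value.\<close>

lemma hp_limit_shift:
  assumes "hp_limit X \<phi> F" "\<And>z. z \<in> X \<Longrightarrow> \<psi> z = \<phi> z + c"
  shows "hp_limit X \<psi> F"
  unfolding hp_limit_def
proof (intro allI impI)
  fix e :: real assume e: "e > 0"
  obtain p q where p: "\<And>z. z \<in> X \<Longrightarrow> cmod (F z - (poly p z * \<phi> z + poly q z)) < e"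
    using hp_limitD[OF assms(1) e] by blast
  show "\<exists>p q. \<forall>z\<in>X. cmod (F z - (poly p z * \<psi> z + poly q z)) < e"
    using p assms(2) by (intro exI[of _ p] exI[of _ "q - smult c p"]) (simp add: algebra_simps)
qed

text \<open>
  The step polynomials are uncontrolled on the strip \<open>a < Re z < b\<close>, but there the other factor
  \<open>u (Re z) - c\<close> vanishes.
\<close>

lemma hp_limit_truncate:
  fixes u :: "real \<Rightarrow> real"
  assumes X: "compact X" and u: "continuous_on (Re ` X) u"
    and ab: "a < b" and const: "\<And>x. a \<le> x \<Longrightarrow> x \<le> b \<Longrightarrow> u x = c"
  shows "hp_limit X (\<lambda>z. u (Re z)) (\<lambda>z. of_real (if Re z \<le> a then 0 else u (Re z) - c))"
  unfolding hp_limit_def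
proof (intro allI impI)
  fix e :: real assume e: "e > 0"
  have "continuous_on X (\<lambda>z. u (Re z) - c)"
    by (intro continuous_intros continuous_on_compose2[OF u]) auto
  then have "bounded ((\<lambda>z. u (Re z) - c) ` X)"
    using X by (intro compact_imp_bounded compact_continuous_image)
  then obtain B where B: "B > 0" "\<And>z. z \<in> X \<Longrightarrow> \<bar>u (Re z) - c\<bar> \<le> B"
    by (auto simp: bounded_pos)
  obtain s where s: "\<And>z. z \<in> X \<Longrightarrow> Re z \<le> a \<Longrightarrow> cmod (poly s z) < e / B"
    "\<And>z. z \<in> X \<Longrightarrow> b \<le> Re z \<Longrightarrow> cmod (poly s z - 1) < e / B"
    using step_polynomial[OF X ab, of "e / B"] e B(1) by auto
  have "cmod (of_real (if Re z \<le> a then 0 else u (Re z) - c) -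
      (poly s z * of_real (u (Re z)) + poly (smult (- of_real c) s) z)) < e" if z: "z \<in> X" for z
  proof -
    have lt: "\<bar>u (Re z) - c\<bar> * y < e" if "0 \<le> y" "y < e / B" for y
    proof -
      have "\<bar>u (Re z) - c\<bar> * y \<le> B * y" using B(2)[OF z] that by (intro mult_right_mono) auto
      also have "\<dots> < B * (e / B)" using that B(1) by (intro mult_strict_left_mono) auto
      finally show ?thesis using B(1) by simp
    qed
    consider "Re z \<le> a" | "a < Re z" "Re z < b" | "b \<le> Re z" by linarith
    then show ?thesis
    proof cases
      case 1
      then have "of_real (if Re z \<le> a then 0 else u (Re z) - c) -
          (poly s z * of_real (u (Re z)) + poly (smult (- of_real c) s) z) =
          - (of_real (u (Re z) - c) * poly s z)"
        by (simp add: algebra_simps)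
      then show ?thesis using lt[OF _ s(1)[OF z 1]]
        by (simp only: norm_minus_cancel norm_mult norm_of_real norm_ge_zero)
    next
      case 2
      then show ?thesis using e const[of "Re z"] by (simp add: algebra_simps)
    next
      case 3
      then have "of_real (if Re z \<le> a then 0 else u (Re z) - c) -
          (poly s z * of_real (u (Re z)) + poly (smult (- of_real c) s) z) =
          - (of_real (u (Re z) - c) * (poly s z - 1))"
        using ab by (simp add: algebra_simps)
      then show ?thesis using lt[OF _ s(2)[OF z 3]]
        by (simp only: norm_minus_cancel norm_mult norm_of_real norm_ge_zero)
    qed
  qed
  then show "\<exists>p q. \<forall>z\<in>X. cmod (of_real (if Re z \<le> a then 0 else u (Re z) - c) -
      (poly p z * of_real (u (Re z)) + poly q z)) < e" by blast
qed

section \<open>Staircases and the extraction of their ramps\<close>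

definition ramp :: "real \<Rightarrow> real \<Rightarrow> real \<Rightarrow> real" where
  "ramp a b x = max 0 (min 1 ((x - a) / (b - a)))"

lemma ramp_bounds: "0 \<le> ramp a b x" "ramp a b x \<le> 1"
  by (auto simp: ramp_def)

lemma ramp_left: "a < b \<Longrightarrow> x \<le> a \<Longrightarrow> ramp a b x = 0"
  using divide_nonpos_pos[of "x - a" "b - a"] by (simp add: ramp_def)

lemma ramp_right: "a < b \<Longrightarrow> b \<le> x \<Longrightarrow> ramp a b x = 1"
  by (simp add: ramp_def min_def max_def divide_le_eq)

lemma continuous_on_ramp [continuous_intros]: "continuous_on S (ramp a b)"
  unfolding ramp_def by (cases "a = b") (auto intro!: continuous_intros)

text \<open>The staircase is constant between consecutive ramps, so \<open>hp_limit_truncate\<close>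
  can cut it there, which leaves the tail of the sum from index \<open>k\<close> on. A single ramp
  is the difference of two consecutive tails, divided by its height
  \<open>h k \<noteq> 0\<close>.\<close>

lemma hp_limit_ramp:
  fixes h \<alpha> \<beta> :: "nat \<Rightarrow> real"
  assumes X: "compact X"
    and \<alpha>\<beta>: "\<And>i. \<alpha> i < \<beta> i" "\<And>i. \<beta> i < \<alpha> (Suc i)" and h: "\<And>i. i < N \<Longrightarrow> h i \<noteq> 0"
    and "k < N"
  shows "hp_limit X (\<lambda>z. of_real (\<Sum>i<N. h i * ramp (\<alpha> i) (\<beta> i) (Re z)))
           (\<lambda>z. of_real (ramp (\<alpha> k) (\<beta> k) (Re z)))"
proof -
  define u where "u = (\<lambda>x. \<Sum>i<N. h i * ramp (\<alpha> i) (\<beta> i) x)"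
  define f where "f = (\<lambda>k x. \<Sum>i\<in>{k..<N}. h i * ramp (\<alpha> i) (\<beta> i) x)"
  have mono\<alpha>: "\<alpha> i \<le> \<alpha> j" if "i \<le> j" for i j
    using that by (rule lift_Suc_mono_le[rotated]) (meson \<alpha>\<beta> less_imp_le less_trans)
  have sep: "\<beta> i < \<alpha> j" if "i < j" for i j
    using \<alpha>\<beta>(2)[of i] mono\<alpha>[of "Suc i" j] that by simp
  have cu: "continuous_on (Re ` X) u"
    unfolding u_def by (intro continuous_intros)
  have split: "u x = (\<Sum>i<k. h i * ramp (\<alpha> i) (\<beta> i) x) + f k x" if "k \<le> N" for k x
    unfolding u_def f_def using that
    by (subst sum.union_disjoint[symmetric]) (auto intro!: sum.cong)
  \<comment> \<open>Every tail comes from one truncation of the full staircase; for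
    \<open>k = 0\<close> it is the staircase itself.\<close>
  have *: "hp_limit X (\<lambda>z. of_real (u (Re z))) (\<lambda>z. of_real (f k (Re z)))" if "k \<le> N" for k
  proof (cases k)
    case 0
    then have "f k = u" by (simp add: f_def u_def lessThan_atLeast0)
    then show ?thesis by (simp add: hp_limit_self)
  next
    case (Suc j)
    \<comment> \<open>The height of the flat step between ramp \<open>j\<close> and ramp
      \<open>k = Suc j\<close>.\<close>
    define c where "c = (\<Sum>i<k. h i)"
    have left: "f k x = 0" if "x \<le> \<alpha> k" for x
      unfolding f_def
    proof (intro sum.neutral ballI)
      fix i assume "i \<in> {k..<N}"
      then show "h i * ramp (\<alpha> i) (\<beta> i) x = 0"
        using that \<alpha>\<beta>(1) mono\<alpha>[of k i] by (subst ramp_left) auto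
    qed
    have right: "u x - c = f k x" if "\<beta> j \<le> x" for x
    proof -
      have "\<beta> i \<le> x" if "i < k" for i
      proof (cases "i = j")
        case False
        then have "i < j" using that Suc by simp
        then show ?thesis using sep[of i j] \<alpha>\<beta>(1)[of j] \<open>\<beta> j \<le> x\<close> by simp
      qed (use \<open>\<beta> j \<le> x\<close> in simp)
      then have "(\<Sum>i<k. h i * ramp (\<alpha> i) (\<beta> i) x) = c"
        unfolding c_def by (intro sum.cong refl) (simp add: ramp_right \<alpha>\<beta>(1))
      then show ?thesis using split[OF \<open>k \<le> N\<close>, of x] by simp
    qed
    have "hp_limit X (\<lambda>z. of_real (u (Re z)))
        (\<lambda>z. of_real (if Re z \<le> \<beta> j then 0 else u (Re z) - c))"
    proof (rule hp_limit_truncate[OF X cu])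
      show "\<beta> j < \<alpha> k" using sep Suc by simp
      show "u x = c" if "\<beta> j \<le> x" "x \<le> \<alpha> k" for x
        using left[OF that(2)] right[OF that(1)] by simp
    qed
    then show ?thesis
    proof (rule hp_limit_cong)
      fix z
      have "\<beta> j < \<alpha> k" using sep Suc by simp
      then show "complex_of_real (if Re z \<le> \<beta> j then 0 else u (Re z) - c) = of_real (f k (Re z))"
        using left[of "Re z"] right[of "Re z"] by auto
    qed
  qed
  have "hp_limit X (\<lambda>z. of_real (u (Re z)))
      (\<lambda>z. of_real (1 / h k) * (of_real (f k (Re z)) + (- 1) * of_real (f (Suc k) (Re z))))"
    using \<open>k < N\<close> by (intro hp_limit_cmult hp_limit_add * X) auto
  then show ?thesis unfolding u_def
  proof (rule hp_limit_cong)
    fix z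
    have "f k (Re z) = h k * ramp (\<alpha> k) (\<beta> k) (Re z) + f (Suc k) (Re z)"
      unfolding f_def using \<open>k < N\<close> by (simp add: sum.atLeast_Suc_lessThan)
    then show "of_real (1 / h k) * (of_real (f k (Re z)) + (- 1) * of_real (f (Suc k) (Re z))) =
        complex_of_real (ramp (\<alpha> k) (\<beta> k) (Re z))"
      using h[OF \<open>k < N\<close>] by simp
  qed
qed

text \<open>At \<open>x\<close> the earlier ramps are complete and telescope to the value of
  \<open>g\<close> at a mesh point, while the later ones are still 0. The one ramp in progress and
  the oscillation of \<open>g\<close> each contribute at most \<open>e\<close>.\<close>

lemma staircase_approx:
  fixes g :: "real \<Rightarrow> real"
  assumes t: "\<And>i. i < N \<Longrightarrow> t i < t (Suc i)" and ab: "\<And>i. i < N \<Longrightarrow> t i \<le> \<alpha> i"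
      "\<And>i. i < N \<Longrightarrow> \<alpha> i < \<beta> i" "\<And>i. i < N \<Longrightarrow> \<beta> i \<le> t (Suc i)"
    and osc: "\<And>i x. i < N \<Longrightarrow> t i \<le> x \<Longrightarrow> x \<le> t (Suc i) \<Longrightarrow> \<bar>g x - g (t i)\<bar> \<le> e"
    and x: "0 < N" "t 0 \<le> x" "x \<le> t N"
  shows "\<bar>g (t 0) + (\<Sum>i<N. (g (t (Suc i)) - g (t i)) * ramp (\<alpha> i) (\<beta> i) x) - g x\<bar> \<le> 2 * e"
  using assms
proof (induction N)
  case (Suc N)
  have e: "0 \<le> e"
    using Suc.prems(5)[of 0 "t 0"] Suc.prems(1)[of 0] by simp
  show ?case
  \<comment> \<open>The induction hypothesis demands a nonempty sum and says nothing for
    \<open>N = 0\<close>; that case goes to the second branch, where \<open>t 0 \<le> x\<close> is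
    given.\<close>
  proof (cases "x \<le> t N \<and> N > 0")
    case True
    have "ramp (\<alpha> N) (\<beta> N) x = 0"
      using Suc.prems(2,3)[of N] True by (intro ramp_left) auto
    then show ?thesis using Suc True by auto
  next
    case False
    then have tN: "t N \<le> x" using Suc.prems(7) by (cases "N = 0") auto
    \<comment> \<open>\<open>t\<close> is known to increase only up to index \<open>N\<close>,
      whereas \<open>lift_Suc_mono_le\<close> wants a whole sequence; \<open>t (min i N)\<close> is
      frozen from \<open>N\<close> on.\<close>
    have le: "t (Suc i) \<le> t N" if "i < N" for i
      using that Suc.prems(1) by (intro lift_Suc_mono_le[of "\<lambda>i. t (min i N)" "Suc i" N, simplified min_absorb1 min.idem])
         (auto simp: min_def not_less_eq_eq intro: less_imp_le)
    have "(\<Sum>i<N. (g (t (Suc i)) - g (t i)) * ramp (\<alpha> i) (\<beta> i) x) = (\<Sum>i<N. g (t (Suc i)) - g (t i))"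
    proof (intro sum.cong refl)
      fix i assume "i \<in> {..<N}"
      then show "(g (t (Suc i)) - g (t i)) * ramp (\<alpha> i) (\<beta> i) x = g (t (Suc i)) - g (t i)"
        using Suc.prems(3,4)[of i] le[of i] tN by (subst ramp_right) auto
    qed
    also have "\<dots> = g (t N) - g (t 0)" by (rule sum_lessThan_telescope)
    finally have "g (t 0) + (\<Sum>i<Suc N. (g (t (Suc i)) - g (t i)) * ramp (\<alpha> i) (\<beta> i) x) - g x =
        (g (t N) - g x) + (g (t (Suc N)) - g (t N)) * ramp (\<alpha> N) (\<beta> N) x"
      by simp
    moreover have "\<bar>g (t N) - g x\<bar> \<le> e"
      using Suc.prems(5)[of N x] tN Suc.prems(8) by simp
    moreover have "\<bar>(g (t (Suc N)) - g (t N)) * ramp (\<alpha> N) (\<beta> N) x\<bar> \<le> e * 1"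
      unfolding abs_mult using Suc.prems(5)[of N "t (Suc N)"] Suc.prems(1)[of N] e
      by (intro mult_mono) (auto simp: ramp_bounds)
    ultimately show ?thesis by (smt (verit))
  qed
qed simp

lemma uniform_mesh:
  fixes g :: "real \<Rightarrow> real"
  assumes "continuous_on {-1..1} g" "e > 0"
  obtains d where "d > 0"
    "\<And>x y. x \<in> {-1..1} \<Longrightarrow> y \<in> {-1..1} \<Longrightarrow> \<bar>x - y\<bar> < d \<Longrightarrow> \<bar>g x - g y\<bar> < e"
  using compact_uniformly_continuous[OF assms(1)] assms(2) that
  unfolding uniformly_continuous_on_def by (auto simp: dist_real_def)

text \<open>One mesh serves both functions. The staircase \<open>s\<close> follows \<open>u\<close>,
  but all its ramps are limits with respect to \<open>s\<close>, so they can be recombined with the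
  increments of \<open>v\<close>.\<close>

lemma hp_limit_dense:
  fixes u v :: "real \<Rightarrow> real"
  assumes u: "continuous_on {-1..1} u" and v: "continuous_on {-1..1} v" and e: "e > 0"
  obtains s where "continuous_on UNIV s" "\<And>x. x \<in> {-1..1} \<Longrightarrow> \<bar>s x - u x\<bar> \<le> e"
    "\<exists>G. hp_limit (cball 0 1) (\<lambda>z. of_real (s (Re z))) G \<and> (\<forall>z\<in>cball 0 1. cmod (of_real (v (Re z)) - G z) < e)"
proof -
  obtain d1 where d1: "d1 > 0"
    "\<And>x y. x \<in> {-1..1} \<Longrightarrow> y \<in> {-1..1} \<Longrightarrow> \<bar>x - y\<bar> < d1 \<Longrightarrow> \<bar>u x - u y\<bar> < e / 4"
    using uniform_mesh[OF u, of "e / 4"] e by auto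
  obtain d2 where d2: "d2 > 0"
    "\<And>x y. x \<in> {-1..1} \<Longrightarrow> y \<in> {-1..1} \<Longrightarrow> \<bar>x - y\<bar> < d2 \<Longrightarrow> \<bar>v x - v y\<bar> < e / 4"
    using uniform_mesh[OF v, of "e / 4"] e by auto
  define d where "d = min d1 d2"
  obtain N where N: "N > 0" "2 / real N < d"
  proof -
    obtain n where "inverse (real (Suc n)) < d / 2"
      using reals_Archimedean[of "d / 2"] d1(1) d2(1) by (auto simp: d_def)
    then show ?thesis using that[of "Suc n"] by (simp add: inverse_eq_divide field_simps)
  qed
  define r where "r = 2 / real N"
  have r: "r > 0" "r < d" using N by (auto simp: r_def)
  define t where "t = (\<lambda>i::nat. - 1 + real i * r)"
  \<comment> \<open>Each ramp fills the first half of its mesh cell; the second half is the flat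
    step on which \<open>hp_limit_ramp\<close> cuts.\<close>
  define \<alpha> where "\<alpha> = t"
  define \<beta> where "\<beta> = (\<lambda>i. t i + r / 2)"
  have tN: "t 0 = -1" "t N = 1" using N(1) by (auto simp: t_def r_def)
  have tS: "t (Suc i) = t i + r" for i by (simp add: t_def algebra_simps)
  have tin: "t i \<in> {-1..1}" if "i \<le> N" for i
    using that N(1) by (auto simp: t_def r_def divide_le_eq)
  have mesh: "x \<in> {-1..1}" "\<bar>x - t i\<bar> < d" if "i < N" "t i \<le> x" "x \<le> t (Suc i)" for i x
    using that tin[of i] tin[of "Suc i"] tS[of i] r(2) by auto
  have stair: "\<bar>g (-1) + (\<Sum>i<N. (g (t (Suc i)) - g (t i)) * ramp (\<alpha> i) (\<beta> i) x) - g x\<bar> \<le> 2 * (e / 4)"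
    if g: "\<And>x y. x \<in> {-1..1} \<Longrightarrow> y \<in> {-1..1} \<Longrightarrow> \<bar>x - y\<bar> < d \<Longrightarrow> \<bar>g x - g y\<bar> < e / 4"
      and x: "x \<in> {-1..1}" for g :: "real \<Rightarrow> real" and x
  proof -
    have "\<bar>g (t 0) + (\<Sum>i<N. (g (t (Suc i)) - g (t i)) * ramp (\<alpha> i) (\<beta> i) x) - g x\<bar> \<le> 2 * (e / 4)"
    proof (rule staircase_approx)
      show "\<bar>g x - g (t i)\<bar> \<le> e / 4" if "i < N" "t i \<le> x" "x \<le> t (Suc i)" for i x
        using g[of x "t i"] mesh[OF that] tin[of i] that(1) by (simp add: less_imp_le)
    qed (use N(1) x tN tS r in \<open>auto simp: \<alpha>_def \<beta>_def\<close>)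
    then show ?thesis by (simp add: tN)
  qed
  \<comment> \<open>A vanishing jump could not be divided out, so it is replaced by
    \<open>e / (4 * N)\<close>; over \<open>N\<close> ramps this costs at most
    \<open>e / 4\<close>.\<close>
  define h where "h = (\<lambda>i. if u (t (Suc i)) = u (t i) then e / (4 * N) else u (t (Suc i)) - u (t i))"
  define s0 where "s0 = (\<lambda>x. \<Sum>i<N. h i * ramp (\<alpha> i) (\<beta> i) x)"
  have ramps: "hp_limit (cball 0 1) (\<lambda>z. of_real (s0 (Re z))) (\<lambda>z. of_real (ramp (\<alpha> k) (\<beta> k) (Re z)))"
    if "k < N" for k
    unfolding s0_def
    by (rule hp_limit_ramp[OF _ _ _ _ that]) (use r tS e N(1) in \<open>auto simp: \<alpha>_def \<beta>_def h_def\<close>)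
  define G where "G = (\<lambda>z. of_real (v (-1)) +
      (\<Sum>i<N. complex_of_real (v (t (Suc i)) - v (t i)) * of_real (ramp (\<alpha> i) (\<beta> i) (Re z))))"
  have "hp_limit (cball 0 1) (\<lambda>z. of_real (s0 (Re z))) (\<lambda>z. of_real (v (-1)))"
    by (rule hp_limit_const)
  then have G0: "hp_limit (cball 0 1) (\<lambda>z. of_real (s0 (Re z))) G"
    unfolding G_def by (intro hp_limit_add hp_limit_sum hp_limit_cmult ramps) auto
  show ?thesis
  proof (rule that[of "\<lambda>x. u (-1) + s0 x"])
    show "continuous_on UNIV (\<lambda>x. u (-1) + s0 x)"
      unfolding s0_def by (intro continuous_intros)
    show "\<bar>u (-1) + s0 x - u x\<bar> \<le> e" if x: "x \<in> {-1..1}" for x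
    proof -
      define s1 where "s1 = (\<Sum>i<N. (u (t (Suc i)) - u (t i)) * ramp (\<alpha> i) (\<beta> i) x)"
      have "\<bar>s0 x - s1\<bar> = \<bar>\<Sum>i<N. (h i - (u (t (Suc i)) - u (t i))) * ramp (\<alpha> i) (\<beta> i) x\<bar>"
        by (simp add: s0_def s1_def sum_subtractf left_diff_distrib)
      also have "\<dots> \<le> (\<Sum>i<N. e / (4 * N))"
      proof (rule order_trans[OF sum_abs sum_mono])
        fix i
        have "\<bar>h i - (u (t (Suc i)) - u (t i))\<bar> * ramp (\<alpha> i) (\<beta> i) x \<le> e / (4 * N) * 1"
          using e by (intro mult_mono) (auto simp: h_def ramp_bounds)
        then show "\<bar>(h i - (u (t (Suc i)) - u (t i))) * ramp (\<alpha> i) (\<beta> i) x\<bar> \<le> e / (4 * N)"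
          by (simp add: abs_mult ramp_bounds)
      qed
      also have "\<dots> = e / 4" using N(1) by simp
      finally have "\<bar>s0 x - s1\<bar> \<le> e / 4" .
      moreover have "\<bar>u (-1) + s1 - u x\<bar> \<le> 2 * (e / 4)"
        unfolding s1_def using d1(2) x by (intro stair) (auto simp: d_def)
      ultimately show ?thesis using e by linarith
    qed
    have "cmod (of_real (v (Re z)) - G z) < e" if z: "z \<in> cball 0 1" for z
    proof -
      have "Re z \<in> {-1..1}" using z abs_Re_le_cmod[of z] by auto
      then have "\<bar>v (-1) + (\<Sum>i<N. (v (t (Suc i)) - v (t i)) * ramp (\<alpha> i) (\<beta> i) (Re z)) - v (Re z)\<bar> \<le> 2 * (e / 4)"
        using d2(2) by (intro stair) (auto simp: d_def)
      moreover have "G z = of_real (v (-1) + (\<Sum>i<N. (v (t (Suc i)) - v (t i)) * ramp (\<alpha> i) (\<beta> i) (Re z)))"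
        by (simp add: G_def)
      ultimately have "cmod (G z - of_real (v (Re z))) \<le> 2 * (e / 4)"
        by (simp only: flip: of_real_diff) (simp only: norm_of_real)
      then show ?thesis using e by (simp add: norm_minus_commute)
    qed
    moreover have "hp_limit (cball 0 1) (\<lambda>z. of_real (u (-1) + s0 (Re z))) G"
      by (rule hp_limit_shift[OF G0, where c = "of_real (u (-1))"]) simp
    ultimately show "\<exists>G. hp_limit (cball 0 1) (\<lambda>z. of_real (u (-1) + s0 (Re z))) G \<and>
        (\<forall>z\<in>cball 0 1. cmod (of_real (v (Re z)) - G z) < e)"
      by blast
  qed
qed

section \<open>Baire category: one function for all powers of the real part\<close>

lemma Baire_complete_space:
  fixes U :: "'i \<Rightarrow> 'a::complete_space set"
  assumes "countable I" "\<And>i. i \<in> I \<Longrightarrow> open (U i)" "\<And>i. i \<in> I \<Longrightarrow> closure (U i) = UNIV"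
  shows "closure (\<Inter>i\<in>I. U i) = UNIV"
proof -
  have "Met_TC.mcomplete TYPE('a)" by (simp add: complete_UNIV)
  moreover have "countable (U ` I)" using assms(1) by simp
  ultimately show ?thesis
    using Met_TC.metric_Baire_category[of "U ` I"] assms(2,3)
    by (auto simp: open_openin[symmetric])
qed

text \<open>For each \<open>m\<close> and \<open>n\<close>, approximability of
  \<open>Re z ^ m\<close> up to \<open>1 / Suc n\<close> is an open condition on \<open>u\<close>,
  and by \<open>hp_limit_dense\<close> a dense one. In the complete space of bounded continuous
  functions, countably many such conditions can be met at once.\<close>

lemma exists_generic_function:
  obtains u :: "real \<Rightarrow>\<^sub>C real"
  where "\<And>m. hp_limit (cball 0 1) (\<lambda>z. of_real (u (Re z))) (\<lambda>z. of_real (Re z) ^ m)"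
proof -
  \<comment> \<open>The bound \<open>r\<close> strictly below \<open>1 / Suc n\<close> leaves a gap
    that is uniform on the disc; half of it absorbs a small change of \<open>u\<close>.\<close>
  define U :: "nat \<times> nat \<Rightarrow> (real \<Rightarrow>\<^sub>C real) set" where
    "U = (\<lambda>(m, n). {u :: real \<Rightarrow>\<^sub>C real. \<exists>p q r. r < 1 / real (Suc n) \<and>
      (\<forall>z\<in>cball 0 1. cmod (of_real (Re z) ^ m - (poly p z * of_real (u (Re z)) + poly q z)) \<le> r)})"
  have "open (U (m, n))" for m n
    unfolding open_dist
  proof (intro ballI)
    fix u assume "u \<in> U (m, n)"
    then obtain p q r where r: "r < 1 / real (Suc n)" and pq: "\<And>z. z \<in> cball 0 1 \<Longrightarrow>
        cmod (of_real (Re z) ^ m - (poly p z * of_real (u (Re z)) + poly q z)) \<le> r"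
      unfolding U_def by (simp only: prod.case mem_Collect_eq) blast
    obtain B where B: "B > 0" "\<And>z. z \<in> cball 0 1 \<Longrightarrow> cmod (poly p z) \<le> B"
      using bounded_poly_image[of "cball 0 1"] by auto
    define k where "k = 1 / real (Suc n)"
    define e where "e = (k - r) / 2"
    have "r < k" using r by (simp only: k_def)
    then have "e > 0" "r + e < k" by (auto simp: e_def field_simps)
    then have e: "e > 0" "r + e < 1 / real (Suc n)" by (simp_all only: k_def)
    show "\<exists>e>0. \<forall>w. dist w u < e \<longrightarrow> w \<in> U (m, n)"
    proof (intro exI[of _ "e / B"] conjI allI impI)
      show "e / B > 0" using e B by simp
      fix w assume w: "dist w u < e / B"
      have "cmod (of_real (Re z) ^ m - (poly p z * of_real (w (Re z)) + poly q z)) \<le> r + e"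
        if z: "z \<in> cball 0 1" for z
      proof -
        have "\<bar>u (Re z) - w (Re z)\<bar> \<le> e / B"
          using dist_bounded[of w "Re z" u] w by (simp add: dist_real_def abs_minus_commute)
        then have "cmod (poly p z) * \<bar>u (Re z) - w (Re z)\<bar> \<le> B * (e / B)"
          using B z by (intro mult_mono) auto
        then have "cmod (poly p z * of_real (u (Re z) - w (Re z))) \<le> e"
          using B(1) by (simp add: norm_mult del: of_real_diff)
        moreover have "of_real (Re z) ^ m - (poly p z * of_real (w (Re z)) + poly q z) =
            (of_real (Re z) ^ m - (poly p z * of_real (u (Re z)) + poly q z)) +
            poly p z * of_real (u (Re z) - w (Re z))"
          by (simp add: algebra_simps)
        ultimately show ?thesis
          using norm_triangle_mono[OF pq[OF z]] by (simp only:)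
      qed
      then show "w \<in> U (m, n)" using e(2) unfolding U_def by blast
    qed
  qed
  moreover have "closure (U (m, n)) = UNIV" for m n
  proof -
    have "\<exists>w\<in>U (m, n). dist w u < e" if e: "e > 0" for u e
    proof -
      define k where "k = 1 / real (Suc n)"
      \<comment> \<open>Below \<open>e\<close> for the distance to \<open>u\<close>, and below half
        of \<open>k\<close> because two errors add up: from the power to \<open>G\<close>, and from
        \<open>G\<close> to the combination of \<open>p\<close> and \<open>q\<close>.\<close>
      define e' where "e' = min (e / 2) (k / 3)"
      have "k > 0" by (simp add: k_def)
      then have "e' > 0" "e' < e" "e' + e' < k"
        using e unfolding e'_def by linarith+
      then have e': "e' > 0" "e' < e" "e' + e' < 1 / real (Suc n)"
        by (simp_all only: k_def)
      have cont: "continuous_on {-1..1} (apply_bcontfun u)" "continuous_on {-1..1} (\<lambda>x::real. x ^ m)"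
        by (auto intro!: continuous_intros)
      obtain s where s: "continuous_on UNIV s" "\<And>x. x \<in> {-1..1} \<Longrightarrow> \<bar>s x - u x\<bar> \<le> e'"
        "\<exists>G. hp_limit (cball 0 1) (\<lambda>z. of_real (s (Re z))) G \<and>
          (\<forall>z\<in>cball 0 1. cmod (of_real (Re z ^ m) - G z) < e')"
        using hp_limit_dense[OF cont e'(1)] by blast
      obtain G where G: "hp_limit (cball 0 1) (\<lambda>z. of_real (s (Re z))) G"
        "\<And>z. z \<in> cball 0 1 \<Longrightarrow> cmod (of_real (Re z ^ m) - G z) < e'"
        using s(3) by blast
      obtain p q where pq: "\<And>z. z \<in> cball 0 1 \<Longrightarrow>
          cmod (G z - (poly p z * of_real (s (Re z)) + poly q z)) < e'"
        using hp_limitD[OF G(1) e'(1)] by blast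
      \<comment> \<open>\<open>s\<close> is close to \<open>u\<close> only on
        \<open>[-1, 1]\<close>. Clamping the argument carries the difference \<open>s - u\<close>
        from there to the whole line, so \<open>f\<close> stays bounded and within \<open>e'\<close>
        of \<open>u\<close> everywhere.\<close>
      define cl where "cl = (\<lambda>x::real. max (-1) (min 1 x))"
      define f where "f = (\<lambda>x. u x + (s (cl x) - u (cl x)))"
      have cl: "cl x \<in> {-1..1}" for x by (auto simp: cl_def)
      have ccl: "continuous_on UNIV cl" unfolding cl_def by (intro continuous_intros)
      have diff: "\<bar>f x - u x\<bar> \<le> e'" for x
        using s(2)[OF cl, of x] by (simp add: f_def)
      have "f \<in> bcontfun"
      proof (rule bcontfun_normI)
        show "continuous_on UNIV f"
          unfolding f_def
          by (intro continuous_intros continuous_on_compose2[OF s(1) ccl]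
              continuous_on_compose2[OF continuous_on_apply_bcontfun ccl]) auto
        show "norm (f x) \<le> norm u + e'" for x
          using diff[of x] norm_bounded[of u x] by simp
      qed
      then obtain w where w: "f = apply_bcontfun w" by (rule bcontfunE)
      have "dist w u \<le> e'"
        using diff by (intro dist_bound) (simp add: dist_real_def flip: w)
      moreover have "w \<in> U (m, n)"
      proof -
        have "cmod (of_real (Re z) ^ m - (poly p z * of_real (w (Re z)) + poly q z)) \<le> e' + e'"
          if z: "z \<in> cball 0 1" for z
        proof -
          have "\<bar>Re z\<bar> \<le> 1" using z abs_Re_le_cmod[of z] by simp
          then have "w (Re z) = s (Re z)" by (auto simp: f_def cl_def simp flip: w)
          then show ?thesis
            using norm_diff_triangle_less[OF G(2)[OF z] pq[OF z]] by (simp add: less_imp_le)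
        qed
        then show ?thesis using e'(3) unfolding U_def by blast
      qed
      ultimately show ?thesis using e'(2) by (intro bexI[of _ w]) auto
    qed
    then show ?thesis by (auto simp: closure_approachable)
  qed
  ultimately have "closure (\<Inter>i\<in>UNIV. U i) = UNIV"
    by (intro Baire_complete_space) auto
  then have "(\<Inter>i. U i) \<noteq> {}" by (metis UNIV_not_empty closure_empty)
  then obtain u where u: "u \<in> (\<Inter>i. U i)" by blast
  show ?thesis
  proof (rule that[of u], unfold hp_limit_def, intro allI impI)
    fix m and e :: real assume "e > 0"
    then obtain n where n: "1 / real (Suc n) < e"
      using reals_Archimedean by (auto simp: inverse_eq_divide)
    have "u \<in> U (m, n)" using u by blast
    then obtain p q r where r: "r < 1 / real (Suc n)" and pq: "\<And>z. z \<in> cball 0 1 \<Longrightarrow>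
        cmod (of_real (Re z) ^ m - (poly p z * of_real (u (Re z)) + poly q z)) \<le> r"
      unfolding U_def by (simp only: prod.case mem_Collect_eq) blast
    then show "\<exists>p q. \<forall>z\<in>cball 0 1. cmod (of_real (Re z) ^ m - (poly p z * of_real (u (Re z)) + poly q z)) < e"
      using n by (intro exI[of _ p] exI[of _ q] ballI) (meson le_less_trans less_trans)
  qed
qed

section \<open>From powers of the real part to all continuous functions\<close>

text \<open>Instead of products of limits, multipliers are considered: the set \<open>S\<close> of
  those \<open>F\<close> all of whose products with powers of \<open>Re z\<close> are limits is
  stable under \<open>Re z\<close> by its very form, under \<open>z\<close> by
  \<open>hp_limit_poly_mult\<close>, and so under \<open>Im z\<close> and every real
  polynomial.\<close>

lemma hp_limit_real_polynomial:
  fixes g :: "complex \<Rightarrow> real"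
  assumes X: "compact X" and x: "\<And>m. hp_limit X \<phi> (\<lambda>z. of_real (Re z) ^ m)"
    and g: "real_polynomial_function g"
  shows "hp_limit X \<phi> (\<lambda>z. of_real (g z))"
proof -
  define S where "S = {F. \<forall>m. hp_limit X \<phi> (\<lambda>z. of_real (Re z) ^ m * F z)}"
  have add: "(\<lambda>z. F z + G z) \<in> S" if "F \<in> S" "G \<in> S" for F G
    using that hp_limit_add unfolding S_def by (fastforce simp: distrib_left)
  have poly: "(\<lambda>z. poly p z * F z) \<in> S" if "F \<in> S" for F p
  proof -
    have "hp_limit X \<phi> (\<lambda>z. poly p z * (of_real (Re z) ^ m * F z))" for m
      using that by (intro hp_limit_poly_mult X) (simp add: S_def)
    then show ?thesis by (simp add: S_def mult_ac)
  qed
  have cmult: "(\<lambda>z. c * F z) \<in> S" if "F \<in> S" for F c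
    using poly[OF that, of "[:c:]"] by simp
  have re: "(\<lambda>z. of_real (Re z) * F z) \<in> S" if "F \<in> S" for F
  proof -
    have "hp_limit X \<phi> (\<lambda>z. of_real (Re z) ^ Suc m * F z)" for m
      using that by (simp only: S_def mem_Collect_eq)
    then show ?thesis by (simp add: S_def mult_ac)
  qed
  have im: "(\<lambda>z. of_real (Im z) * F z) \<in> S" if "F \<in> S" for F
  proof -
    \<comment> \<open>\<open>Im z\<close> is \<open>- \<i> * (z - Re z)\<close>; the polynomial
      \<open>[:0, 1:]\<close> supplies the factor \<open>z\<close>.\<close>
    have "(\<lambda>z. (- \<i>) * (poly [:0, 1:] z * F z + (- 1) * (of_real (Re z) * F z))) \<in> S"
      by (intro cmult add poly re that)
    moreover have "(- \<i>) * (poly [:0, 1:] z * F z + (- 1) * (of_real (Re z) * F z)) = of_real (Im z) * F z" for z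
      by (subst (2) complex_eq) (simp add: algebra_simps)
    ultimately show ?thesis by simp
  qed
  have mult: "\<forall>F\<in>S. (\<lambda>z. of_real (g z) * F z) \<in> S"
    using g
  proof (induction rule: real_polynomial_function.induct)
    case (linear f)
    interpret f: bounded_linear f by fact
    have f: "f z = f 1 * Re z + f \<i> * Im z" for z
    proof -
      have "z = Re z *\<^sub>R 1 + Im z *\<^sub>R \<i>" by (simp add: complex_eq_iff)
      then have "f z = f (Re z *\<^sub>R 1 + Im z *\<^sub>R \<i>)" by (rule arg_cong)
      then show ?thesis by (simp add: f.add f.scaleR)
    qed
    show ?case
    proof
      fix F assume F: "F \<in> S"
      have "(\<lambda>z. of_real (f 1) * (of_real (Re z) * F z) + of_real (f \<i>) * (of_real (Im z) * F z)) \<in> S"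
        by (intro add cmult re im F)
      then show "(\<lambda>z. of_real (f z) * F z) \<in> S"
        by (subst f) (simp add: algebra_simps)
    qed
  next
    case (add f g)
    then show ?case using \<open>\<And>F G. F \<in> S \<Longrightarrow> G \<in> S \<Longrightarrow> (\<lambda>z. F z + G z) \<in> S\<close>
      by (auto simp: distrib_right)
  next
    case (mult f g)
    then show ?case by (auto simp: mult.assoc)
  qed (use cmult in auto)
  have "(\<lambda>z. 1) \<in> S" using x by (simp add: S_def)
  then have "(\<lambda>z. of_real (g z)) \<in> S" using bspec[OF mult] by fastforce
  then have "hp_limit X \<phi> (\<lambda>z. of_real (Re z) ^ 0 * of_real (g z))"
    unfolding S_def by blast
  then show ?thesis by simp
qed

lemma hp_limit_continuous:
  assumes X: "compact X" and x: "\<And>m. hp_limit X \<phi> (\<lambda>z. of_real (Re z) ^ m)"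
    and f: "continuous_on X f"
  shows "hp_limit X \<phi> f"
proof (rule hp_limit_closed)
  fix e :: real assume "e > 0"
  then obtain g where g: "polynomial_function g" "\<forall>z\<in>X. cmod (f z - g z) < e"
    using Stone_Weierstrass_polynomial_function[OF X f] by blast
  have "real_polynomial_function (Re \<circ> g)" "real_polynomial_function (Im \<circ> g)"
    using g(1) bounded_linear_Re bounded_linear_Im unfolding polynomial_function_def by auto
  then have "hp_limit X \<phi> (\<lambda>z. of_real ((Re \<circ> g) z) + \<i> * of_real ((Im \<circ> g) z))"
    by (intro hp_limit_add hp_limit_cmult hp_limit_real_polynomial X x)
  then have "hp_limit X \<phi> g"
    by (simp flip: complex_eq)
  with g(2) show "\<exists>G. hp_limit X \<phi> G \<and> (\<forall>z\<in>X. cmod (f z - G z) < e)" by blast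
qed

section \<open>The Swiss cheese\<close>

text \<open>The residue theorem on the plane with all zeros of \<open>q\<close> as exceptional
  points: none lies on the circle, those inside have winding number 1 and those outside 0.\<close>

lemma contour_integral_circle_rational:
  assumes r: "r > 0" and q: "q \<noteq> 0" "\<And>z. z \<in> sphere a r \<Longrightarrow> poly q z \<noteq> 0"
  shows "contour_integral (circlepath a r) (\<lambda>z. poly p z / poly q z) =
    2 * pi * \<i> * (\<Sum>w | poly q w = 0 \<and> w \<in> ball a r. residue (\<lambda>z. poly p z / poly q z) w)"
proof -
  define Z where "Z = {w. poly q w = 0}"
  have fin: "finite Z" using q(1) by (simp add: Z_def poly_roots_finite)
  have "contour_integral (circlepath a r) (\<lambda>z. poly p z / poly q z) =
      2 * pi * \<i> * (\<Sum>w\<in>Z. winding_number (circlepath a r) w * residue (\<lambda>z. poly p z / poly q z) w)"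
  proof (rule Residue_theorem)
    show "(\<lambda>z. poly p z / poly q z) holomorphic_on UNIV - Z"
      by (intro holomorphic_intros) (auto simp: Z_def)
    show "path_image (circlepath a r) \<subseteq> UNIV - Z"
      using q(2) r by (auto simp: Z_def)
  qed (use fin in auto)
  also have "(\<Sum>w\<in>Z. winding_number (circlepath a r) w * residue (\<lambda>z. poly p z / poly q z) w) =
      (\<Sum>w\<in>Z. if w \<in> ball a r then residue (\<lambda>z. poly p z / poly q z) w else 0)"
  proof (intro sum.cong refl)
    fix w assume w: "w \<in> Z"
    show "winding_number (circlepath a r) w * residue (\<lambda>z. poly p z / poly q z) w =
        (if w \<in> ball a r then residue (\<lambda>z. poly p z / poly q z) w else 0)"
    proof (cases "w \<in> ball a r")
      case True
      then show ?thesis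
        by (simp add: winding_number_circlepath dist_norm norm_minus_commute)
    next
      case False
      then have "w \<notin> cball a r" using w q(2)[of w] by (auto simp: Z_def)
      then have "winding_number (circlepath a r) w = 0"
        using r by (intro winding_number_zero_outside[of _ "cball a r"]) auto
      then show ?thesis using False by simp
    qed
  qed
  also have "\<dots> = (\<Sum>w | poly q w = 0 \<and> w \<in> ball a r. residue (\<lambda>z. poly p z / poly q z) w)"
    using fin by (simp add: Z_def sum.If_cases Int_def)
  finally show ?thesis .
qed

text \<open>On the circle, \<open>cnj z\<close> agrees with \<open>r ^ 2 / (z - a) + cnj a\<close>,
  to which Cauchy's formula and Cauchy's theorem apply.\<close>

lemma has_contour_integral_cnj_circlepath:
  assumes "r > 0"
  shows "(cnj has_contour_integral of_real (2 * pi * r ^ 2) * \<i>) (circlepath a r)"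
proof -
  have "((\<lambda>z. of_real (r ^ 2) / (z - a)) has_contour_integral 2 * of_real pi * \<i> * of_real (r ^ 2)) (circlepath a r)"
    by (rule Cauchy_integral_circlepath_simple[of "\<lambda>z. of_real (r ^ 2)"]) (use assms in auto)
  moreover have "((\<lambda>z. cnj a) has_contour_integral 0) (circlepath a r)"
    by (rule Cauchy_theorem_disc_simple[of _ a "2 * r"]) (use assms in auto)
  ultimately have "((\<lambda>z. of_real (r ^ 2) / (z - a) + cnj a) has_contour_integral 2 * of_real pi * \<i> * of_real (r ^ 2) + 0) (circlepath a r)"
    by (rule has_contour_integral_add)
  then have "(cnj has_contour_integral 2 * of_real pi * \<i> * of_real (r ^ 2) + 0) (circlepath a r)"
  proof (rule has_contour_integral_eq)
    fix z assume "z \<in> path_image (circlepath a r)"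
    then have z: "cmod (z - a) = r" using assms by (auto simp: dist_norm norm_minus_commute)
    then have "z \<noteq> a" using assms by auto
    moreover have "(z - a) * cnj (z - a) = of_real (r ^ 2)"
      using z by (simp add: complex_norm_square[symmetric] del: complex_cnj_diff)
    ultimately have "of_real (r ^ 2) / (z - a) = cnj (z - a)"
      by (simp add: divide_eq_eq mult.commute del: complex_cnj_diff)
    then show "of_real (r ^ 2) / (z - a) + cnj a = cnj z" by simp
  qed
  then show ?thesis by (simp add: mult_ac)
qed

lemma contour_integral_circle_cnj_bound:
  assumes "r > 0" "e \<ge> 0" "f contour_integrable_on circlepath a r"
    and "\<And>z. z \<in> sphere a r \<Longrightarrow> cmod (f z - cnj z) \<le> e"
  shows "cmod (contour_integral (circlepath a r) f - of_real (2 * pi * r ^ 2) * \<i>) \<le> e * (2 * pi * r)"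
proof (rule has_contour_integral_bound_circlepath)
  show "((\<lambda>z. f z - cnj z) has_contour_integral
      contour_integral (circlepath a r) f - of_real (2 * pi * r ^ 2) * \<i>) (circlepath a r)"
    using has_contour_integral_diff[OF has_contour_integral_integral[OF assms(3)]
        has_contour_integral_cnj_circlepath[OF assms(1), of a]] by simp
  show "cmod (f z - cnj z) \<le> e" if "cmod (z - a) = r" for z
    using assms(4)[of z] that by (simp add: dist_norm norm_minus_commute)
qed (use assms in auto)

section \<open>Finite families of discs and the distance of conjugation from rational
  functions\<close>

text \<open>Disjointness and containment are asked of the closed discs, so that the boundary circles
  remain in the cheese, where the approximation can be integrated.\<close>

definition disc_family :: "(complex \<times> real) set \<Rightarrow> bool" where
  "disc_family F \<longleftrightarrow> finite F \<and> (\<forall>(a, r)\<in>F. r > 0 \<and> cball a r \<subseteq> ball 0 1) \<and>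
     pairwise (\<lambda>(a, r) (b, s). cball a r \<inter> cball b s = {}) F"

lemma disc_familyD:
  assumes "disc_family F" "(a, r) \<in> F"
  shows "r > 0" "cball a r \<subseteq> ball 0 1"
    "(b, s) \<in> F \<Longrightarrow> (b, s) \<noteq> (a, r) \<Longrightarrow> cball a r \<inter> cball b s = {}"
  using assms unfolding disc_family_def pairwise_def by fastforce+

lemma disc_family_sphere:
  assumes "disc_family F" "(a, r) \<in> F"
  shows "sphere a r \<subseteq> cball 0 1 - (\<Union>(a, r)\<in>F. ball a r)"
proof -
  have "z \<notin> ball b s" if z: "z \<in> sphere a r" and bs: "(b, s) \<in> F" for z b s
  proof (cases "(b, s) = (a, r)")
    case False
    then have "cball a r \<inter> cball b s = {}" using disc_familyD(3)[OF assms bs] by simp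
    then show ?thesis using z by auto
  qed (use z in auto)
  moreover have "sphere a r \<subseteq> cball 0 1"
    using disc_familyD(2)[OF assms] ball_subset_cball sphere_cball by blast
  ultimately show ?thesis by blast
qed

lemma disc_family_unit_sphere:
  assumes "disc_family F"
  shows "sphere 0 1 \<subseteq> cball 0 1 - (\<Union>(a, r)\<in>F. ball a r)"
proof -
  have "z \<notin> ball a r" if "z \<in> sphere 0 1" "(a, r) \<in> F" for z a r
  proof -
    have "ball a r \<subseteq> ball 0 1" using disc_familyD(2)[OF assms that(2)] ball_subset_cball by blast
    then show ?thesis using that(1) by auto
  qed
  then show ?thesis by force
qed

text \<open>
  The contour integral over the outer circle minus those over the boundaries of the discs annihilates
  the rational functions with poles off the cheese, but not \<open>cnj\<close>.
\<close>

lemma rational_far_from_cnj: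
  assumes family: "disc_family F" and sum: "(\<Sum>(a, r)\<in>F. r) \<le> 1 / 2"
    and q: "q \<noteq> 0" "\<And>z. z \<in> cball 0 1 \<Longrightarrow> poly q z = 0 \<Longrightarrow> z \<in> (\<Union>(a, r)\<in>F. ball a r)"
    and e: "\<And>z. z \<in> sphere 0 1 \<union> (\<Union>(a, r)\<in>F. sphere a r) \<Longrightarrow> cmod (poly p z / poly q z - cnj z) \<le> e" "e \<ge> 0"
  shows "e \<ge> 1 / 2"
proof -
  have F: "finite F" "\<And>a r. (a, r) \<in> F \<Longrightarrow> r > 0 \<and> cball a r \<subseteq> ball 0 1"
    and disj: "pairwise (\<lambda>(a, r) (b, s). cball a r \<inter> cball b s = {}) F"
    using family by (auto simp: disc_family_def)
  define f where "f = (\<lambda>z. poly p z / poly q z)"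
  define I where "I = (\<lambda>(a, r). contour_integral (circlepath a r) f)"
  define Z where "Z = (\<lambda>(a, r). {w. poly q w = 0 \<and> w \<in> ball a r})"
  have fin: "finite (Z d)" for d
    using poly_roots_finite[OF q(1)] by (auto simp: Z_def split: prod.splits intro: finite_subset)
  have Zdisj: "Z d \<inter> Z d' = {}" if "d \<in> F" "d' \<in> F" "d \<noteq> d'" for d d'
  proof -
    obtain a r b s where d: "d = (a, r)" "d' = (b, s)" by (cases d, cases d')
    then have "cball a r \<inter> cball b s = {}" using pairwiseD[OF disj that] by simp
    then show ?thesis using ball_subset_cball unfolding d Z_def by fast
  qed
  note circ = disc_family_sphere[OF family] and outer = disc_family_unit_sphere[OF family]
  have integrable: "f contour_integrable_on circlepath a r"
    if "sphere a r \<subseteq> cball 0 1 - (\<Union>(a, r)\<in>F. ball a r)" "r > 0" for a r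
    unfolding f_def
    by (rule contour_integrable_continuous_circlepath)
       (use that q(2) in \<open>auto intro!: continuous_intros\<close>)
  have int: "I (a, r) = 2 * pi * \<i> * (\<Sum>w\<in>Z (a, r). residue f w)"
    if "sphere a r \<subseteq> cball 0 1 - (\<Union>(a, r)\<in>F. ball a r)" "r > 0" for a r
  proof -
    have "poly q z \<noteq> 0" if "z \<in> sphere a r" for z
      using \<open>sphere a r \<subseteq> _\<close> that q(2)[of z] by blast
    then show ?thesis
      using contour_integral_circle_rational[OF that(2) q(1), of a p] by (simp add: I_def Z_def f_def)
  qed
  have bound: "cmod (I (a, r) - of_real (2 * pi * r ^ 2) * \<i>) \<le> e * (2 * pi * r)"
    if "sphere a r \<subseteq> cball 0 1 - (\<Union>(a, r)\<in>F. ball a r)" "r > 0"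
      "sphere a r \<subseteq> sphere 0 1 \<union> (\<Union>(a, r)\<in>F. sphere a r)" for a r
    unfolding I_def prod.case
  proof (intro contour_integral_circle_cnj_bound integrable that(1,2) e(2))
    show "cmod (f z - cnj z) \<le> e" if "z \<in> sphere a r" for z
      using e(1)[OF subsetD[OF \<open>sphere a r \<subseteq> sphere 0 1 \<union> _\<close> that]] by (simp only: f_def)
  qed
  \<comment> \<open>Zeros of \<open>q\<close> in the unit disc lie in removed discs only, each in
    exactly one, so the outer integral picks up the same residues as the inner ones
    together.\<close>
  have "Z (0, 1) = (\<Union>d\<in>F. Z d)"
  proof (intro equalityI subsetI)
    fix w assume w: "w \<in> Z (0, 1)"
    then have "poly q w = 0" "w \<in> cball 0 1" by (auto simp: Z_def)
    with q(2)[of w] obtain a r where "(a, r) \<in> F" "w \<in> ball a r" by blast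
    then show "w \<in> (\<Union>d\<in>F. Z d)" using \<open>poly q w = 0\<close> by (intro UN_I[of "(a, r)"]) (auto simp: Z_def)
  next
    fix w assume "w \<in> (\<Union>d\<in>F. Z d)"
    then obtain a r where ar: "(a, r) \<in> F" "poly q w = 0" "w \<in> ball a r" by (auto simp: Z_def)
    then have "w \<in> ball 0 1" using F(2)[OF ar(1)] ball_subset_cball by blast
    then show "w \<in> Z (0, 1)" using ar(2) by (simp add: Z_def)
  qed
  then have "(\<Sum>w\<in>Z (0, 1). residue f w) = (\<Sum>d\<in>F. \<Sum>w\<in>Z d. residue f w)"
    using F(1) fin Zdisj by (simp add: sum.UNION_disjoint)
  then have "I (0, 1) = (\<Sum>d\<in>F. I d)"
  proof -
    have "(\<Sum>d\<in>F. I d) = (\<Sum>d\<in>F. 2 * pi * \<i> * (\<Sum>w\<in>Z d. residue f w))"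
    proof (intro sum.cong refl)
      fix d assume "d \<in> F"
      then show "I d = 2 * pi * \<i> * (\<Sum>w\<in>Z d. residue f w)"
        using int[OF circ] F(2) by (cases d) blast
    qed
    also have "\<dots> = 2 * pi * \<i> * (\<Sum>d\<in>F. \<Sum>w\<in>Z d. residue f w)"
      by (simp add: sum_distrib_left)
    also have "\<dots> = I (0, 1)"
      using int[OF outer] \<open>(\<Sum>w\<in>Z (0, 1). residue f w) = _\<close> by simp
    finally show ?thesis by (rule sym)
  qed
  moreover have "(\<Sum>(a, r)\<in>F. I (a, r) - of_real (2 * pi * r ^ 2) * \<i>) =
      (\<Sum>d\<in>F. I d) - of_real (2 * pi * (\<Sum>(a, r)\<in>F. r ^ 2)) * \<i>"
    by (simp add: sum_subtractf case_prod_unfold sum_distrib_left sum_distrib_right)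
  \<comment> \<open>The left side is \<open>2 * \<i>\<close> times the area of the finite cheese.
    The integrals of the rational function cancel, so the right side consists of its deviations from
    \<open>cnj\<close> alone.\<close>
  ultimately have eq: "of_real (2 * pi * (1 - (\<Sum>(a, r)\<in>F. r ^ 2))) * \<i> =
      (\<Sum>(a, r)\<in>F. I (a, r) - of_real (2 * pi * r ^ 2) * \<i>) - (I (0, 1) - of_real (2 * pi) * \<i>)"
    by (simp only: of_real_diff right_diff_distrib left_diff_distrib mult_1_right) simp
  \<comment> \<open>The inner circles contribute at most \<open>pi * e\<close>, by the bound on the
    sum of the radii, and the unit circle at most \<open>2 * pi * e\<close>.\<close>
  have arith: "x \<le> 3 * pi * e"
    if "x \<le> y + z" "y \<le> s" "s = t" "t \<le> e * (2 * pi) * (1 / 2)" "z \<le> e * (2 * pi)"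
    for x y z s t :: real
    using that by (simp add: algebra_simps)
  from eq have "cmod (of_real (2 * pi * (1 - (\<Sum>(a, r)\<in>F. r ^ 2))) * \<i>) \<le>
      cmod (\<Sum>(a, r)\<in>F. I (a, r) - of_real (2 * pi * r ^ 2) * \<i>) + cmod (I (0, 1) - of_real (2 * pi) * \<i>)"
    by (simp only: norm_triangle_ineq4)
  moreover have "cmod (\<Sum>(a, r)\<in>F. I (a, r) - of_real (2 * pi * r ^ 2) * \<i>) \<le> (\<Sum>(a, r)\<in>F. e * (2 * pi * r))"
  proof (rule sum_norm_le)
    fix d assume "d \<in> F"
    then obtain a r where ar: "d = (a, r)" "(a, r) \<in> F" by (cases d) auto
    then have "cmod (I (a, r) - of_real (2 * pi * r ^ 2) * \<i>) \<le> e * (2 * pi * r)"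
      using F(2)[OF ar(2)] by (intro bound circ) auto
    then show "cmod (case d of (a, r) \<Rightarrow> I (a, r) - of_real (2 * pi * r ^ 2) * \<i>) \<le>
        (case d of (a, r) \<Rightarrow> e * (2 * pi * r))"
      by (simp add: ar(1))
  qed
  moreover have "(\<Sum>(a, r)\<in>F. e * (2 * pi * r)) = e * (2 * pi) * (\<Sum>(a, r)\<in>F. r)"
    by (simp add: sum_distrib_left case_prod_unfold mult.assoc)
  moreover have "\<dots> \<le> e * (2 * pi) * (1 / 2)"
    using sum e(2) by (intro mult_left_mono) auto
  moreover have "cmod (I (0, 1) - of_real (2 * pi) * \<i>) \<le> e * (2 * pi)"
    using bound[OF outer] by simp
  ultimately have "cmod (of_real (2 * pi * (1 - (\<Sum>(a, r)\<in>F. r ^ 2))) * \<i>) \<le> 3 * pi * e"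
    by (rule arith)
  then have "2 * pi * \<bar>1 - (\<Sum>(a, r)\<in>F. r ^ 2)\<bar> \<le> 3 * pi * e"
    by (simp only: norm_mult norm_of_real) (simp add: abs_mult)
  \<comment> \<open>Each radius is at most the sum of all, hence at most \<open>1 / 2\<close>, so
    its square is at most half of it.\<close>
  moreover have "(\<Sum>(a, r)\<in>F. r ^ 2) \<le> 1 / 4"
  proof -
    have pos: "0 \<le> snd d" if "d \<in> F" for d using F(2)[of "fst d" "snd d"] that by auto
    have le: "snd d \<le> 1 / 2" if "d \<in> F" for d
      using member_le_sum[of d F snd] pos that F(1) sum by (auto simp: case_prod_unfold)
    have "(\<Sum>(a, r)\<in>F. r ^ 2) \<le> (\<Sum>(a, r)\<in>F. r * (1 / 2))"
      unfolding case_prod_unfold power2_eq_square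
      using pos le by (intro sum_mono mult_left_mono) auto
    also have "\<dots> = (\<Sum>(a, r)\<in>F. r) * (1 / 2)"
      by (simp add: sum_distrib_right case_prod_unfold)
    finally show ?thesis using sum by simp
  qed
  ultimately have "2 * pi * (3 / 4) \<le> 3 * pi * e"
    using mult_left_mono[of "3 / 4" "\<bar>1 - (\<Sum>(a, r)\<in>F. r ^ 2)\<bar>" "2 * pi"] by auto
  then show ?thesis by simp
qed

section \<open>Construction of the Swiss cheese\<close>

text \<open>A point outside the finitely many closed discs has a neighbourhood that avoids them,
  with room for a new disc of radius at most \<open>e\<close>. Only closed discs are claimed to
  cover \<open>w\<close>: around a point of a boundary circle no disjoint disc can be added.\<close>

lemma disc_family_extend:
  assumes F: "disc_family F" and w: "w \<in> ball 0 1" and e: "e > 0"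
  obtains F' where "disc_family F'" "F \<subseteq> F'" "w \<in> (\<Union>(a, r)\<in>F'. cball a r)"
    "(\<Sum>(a, r)\<in>F'. r) \<le> (\<Sum>(a, r)\<in>F. r) + e"
proof (cases "w \<in> (\<Union>(a, r)\<in>F. cball a r)")
  case True
  with F e that[of F] show ?thesis by simp
next
  case False
  define W where "W = ball 0 1 - (\<Union>(a, r)\<in>F. cball a r)"
  have fin: "finite F" using F by (simp add: disc_family_def)
  have "open W"
    unfolding W_def using fin by (intro open_Diff closed_UN) auto
  moreover have "w \<in> W" using w False by (simp add: W_def)
  ultimately obtain d where d: "d > 0" "cball w d \<subseteq> W" using open_contains_cball by blast
  define r where "r = min d e"
  have r: "r > 0" "r \<le> e" "cball w r \<subseteq> W" using d e by (auto simp: r_def)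
  have notin: "(w, r) \<notin> F" using False r(1) by force
  show ?thesis
  proof (rule that[of "insert (w, r) F"])
    have "cball w r \<inter> cball a s = {}" if "(a, s) \<in> F" for a s
      using r(3) that unfolding W_def by fastforce
    moreover have "cball w r \<subseteq> ball 0 1" using r(3) by (auto simp: W_def)
    ultimately show "disc_family (insert (w, r) F)"
      using F r(1) by (auto simp: disc_family_def pairwise_insert Int_commute)
    show "(\<Sum>(a, r)\<in>insert (w, r) F. r) \<le> (\<Sum>(a, r)\<in>F. r) + e"
      using notin fin r(2) by simp
  qed (use r(1) in auto)
qed

text \<open>Each stage covers the next point of a countable dense subset of the disc, with a radius
  taken from a geometric budget.\<close>

lemma swiss_cheese:
  obtains F :: "nat \<Rightarrow> (complex \<times> real) set"
  where "\<And>n. disc_family (F n)" "incseq F" "\<And>n. (\<Sum>(a, r)\<in>F n. r) \<le> 1 / 2"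
    "ball 0 1 \<subseteq> closure (\<Union>n. \<Union>(a, r)\<in>F n. ball a r)"
proof -
  obtain Q :: "complex set" where Q: "countable Q" "\<And>U. open U \<Longrightarrow> U \<noteq> {} \<Longrightarrow> \<exists>w\<in>Q. w \<in> U"
    using countable_dense_setE by metis
  define Q' where "Q' = Q \<inter> ball 0 1"
  have "Q' \<noteq> {}" using Q(2)[of "ball 0 1"] by (auto simp: Q'_def)
  moreover have "countable Q'" using Q(1) by (simp add: Q'_def)
  ultimately have range: "range (from_nat_into Q') = Q'" by (intro range_from_nat_into)
  define w where "w = from_nat_into Q'"
  have w: "w n \<in> ball 0 1" for n
    using range unfolding w_def Q'_def by blast
  \<comment> \<open>The budget is 0 at \<open>n = 0\<close>, where the empty family qualifies, and
    grows by \<open>(1 / 2) ^ Suc (Suc n)\<close> at each stage without ever reaching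
    \<open>1 / 2\<close>.\<close>
  define P where "P = (\<lambda>n F. disc_family F \<and> (\<Sum>(a, r)\<in>F. r) \<le> 1 / 2 - (1 / 2) ^ Suc n)"
  have "\<exists>F. \<forall>n. P n (F n) \<and> (F n \<subseteq> F (Suc n) \<and> w n \<in> (\<Union>(a, r)\<in>F (Suc n). cball a r))"
  proof (rule dependent_nat_choice)
    show "\<exists>F. P 0 F" by (intro exI[of _ "{}"]) (simp add: P_def disc_family_def)
    fix F n assume F: "P n F"
    then obtain F' where "disc_family F'" "F \<subseteq> F'" "w n \<in> (\<Union>(a, r)\<in>F'. cball a r)"
      "(\<Sum>(a, r)\<in>F'. r) \<le> (\<Sum>(a, r)\<in>F. r) + (1 / 2) ^ Suc (Suc n)"
      using disc_family_extend[of F "w n" "(1 / 2) ^ Suc (Suc n)"] w unfolding P_def by auto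
    with F show "\<exists>F'. P (Suc n) F' \<and> (F \<subseteq> F' \<and> w n \<in> (\<Union>(a, r)\<in>F'. cball a r))"
      unfolding P_def by (intro exI[of _ F']) auto
  qed
  then obtain F where F: "\<And>n. P n (F n)" "\<And>n. F n \<subseteq> F (Suc n)"
    "\<And>n. w n \<in> (\<Union>(a, r)\<in>F (Suc n). cball a r)" by blast
  show ?thesis
  proof (rule that[of F])
    show "disc_family (F n)" for n using F(1) by (simp add: P_def)
    show "incseq F" using F(2) by (rule incseq_SucI)
    show "(\<Sum>(a, r)\<in>F n. r) \<le> 1 / 2" for n
      using F(1)[of n] zero_le_power[of "1 / 2 :: real" "Suc n"] unfolding P_def by linarith
    \<comment> \<open>A point of the closed disc, even on its boundary, is in the closure of the
      open disc, because the radius is positive.\<close>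
    have "w n \<in> closure (\<Union>n. \<Union>(a, r)\<in>F n. ball a r)" for n
    proof -
      obtain a r where ar: "(a, r) \<in> F (Suc n)" "w n \<in> cball a r" using F(3)[of n] by auto
      then have "r > 0" using F(1)[of "Suc n"] by (auto simp: P_def disc_family_def)
      then have "w n \<in> closure (ball a r)" using ar(2) by simp
      moreover have "ball a r \<subseteq> (\<Union>n. \<Union>(a, r)\<in>F n. ball a r)" using ar(1) by blast
      ultimately show ?thesis using closure_mono by blast
    qed
    then have "range w \<subseteq> closure (\<Union>n. \<Union>(a, r)\<in>F n. ball a r)" by (rule image_subsetI)
    then have Q'sub: "Q' \<subseteq> closure (\<Union>n. \<Union>(a, r)\<in>F n. ball a r)"
      using range by (simp only: w_def)
    show "ball 0 1 \<subseteq> closure (\<Union>n. \<Union>(a, r)\<in>F n. ball a r)" (is "_ \<subseteq> closure ?V")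
    proof (rule ccontr)
      assume "\<not> ?thesis"
      then have "ball 0 1 - closure ?V \<noteq> {}" by blast
      moreover have "open (ball 0 1 - closure ?V)" by (intro open_Diff) auto
      ultimately obtain x where "x \<in> Q" "x \<in> ball 0 1 - closure ?V"
        using Q(2) by meson
      then show False using Q'sub by (auto simp: Q'_def)
    qed
  qed
qed

section \<open>The full cheese and its function spaces\<close>

text \<open>Meant for the finitely many zeros of one denominator in the unit disc: a single stage
  removes them all, which reduces the infinite cheese to a finite family.\<close>

lemma finite_subset_incseq:
  assumes "finite Z" "incseq V" "Z \<subseteq> (\<Union>n. V n)"
  obtains n :: nat where "Z \<subseteq> V n"
proof -
  have "\<exists>n. Z \<subseteq> V n"
    using assms(1,3)
  proof (induction Z)
    case (insert z Z)
    then obtain m n where "Z \<subseteq> V m" "z \<in> V n" by auto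
    moreover have "V m \<subseteq> V (max m n)" "V n \<subseteq> V (max m n)"
      using assms(2) by (simp_all add: incseq_def)
    ultimately show ?case by (intro exI[of _ "max m n"]) blast
  qed simp
  then show ?thesis using that by blast
qed

lemma subset_C_closure:
  assumes "S \<subseteq> C_alg K"
  shows "S \<subseteq> C_closure K S"
  using assms closure_of_subset[of S "mtopology_of (C_metric K)"]
  by (simp add: C_closure_def C_alg_def)

lemma C_closure_subset: "C_closure K S \<subseteq> C_alg K"
  using closure_of_subset_topspace[of "mtopology_of (C_metric K)" S]
  by (simp add: C_closure_def C_alg_def)

theorem proposition1:
  shows "\<exists>(K :: complex set) \<phi>. compact K \<and> \<phi> \<in> A_alg K \<and> R_alg K \<noteq> A_alg K \<and> A_alg K = HP_space \<phi> K"
proof -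
  obtain F :: "nat \<Rightarrow> (complex \<times> real) set"
    where F: "\<And>n. disc_family (F n)" "incseq F" "\<And>n. (\<Sum>(a, r)\<in>F n. r) \<le> 1 / 2"
      "ball 0 1 \<subseteq> closure (\<Union>n. \<Union>(a, r)\<in>F n. ball a r)"
    using swiss_cheese by blast
  define V where "V = (\<lambda>n. \<Union>(a, r)\<in>F n. ball a r)"
  \<comment> \<open>Open discs are removed, which keeps \<open>K\<close> compact and leaves all
    boundary circles in it.\<close>
  define K where "K = cball 0 1 - (\<Union>n. V n)"
  have V: "incseq V"
    using F(2) unfolding V_def incseq_def by blast
  have "open (\<Union>n. V n)" unfolding V_def by (intro open_UN ballI) auto
  then have K: "compact K" unfolding K_def by (intro compact_diff) auto
  have "interior K \<subseteq> ball 0 1"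
    using interior_mono[of K "cball 0 1"] by (auto simp: K_def)
  then have "interior K \<subseteq> closure (\<Union>n. V n)" using F(4) unfolding V_def by blast
  moreover have "interior K \<inter> (\<Union>n. V n) = {}" using interior_subset[of K] by (auto simp: K_def)
  \<comment> \<open>An open set that meets the closure of the union of the discs meets the union
    itself.\<close>
  ultimately have "interior K = {}"
    using open_Int_closure_eq_empty[of "interior K" "\<Union>n. V n"] by auto
  then have A: "A_alg K = C_alg K" by (auto simp: A_alg_def analytic_on_def)
  obtain u :: "real \<Rightarrow>\<^sub>C real"
    where u: "\<And>m. hp_limit (cball 0 1) (\<lambda>z. of_real (u (Re z))) (\<lambda>z. of_real (Re z) ^ m)"
    using exists_generic_function by blast
  define \<psi> where "\<psi> = (\<lambda>z. complex_of_real (u (Re z)))"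
  define \<phi> where "\<phi> = restrict \<psi> K"
  have cont: "continuous_on K \<psi>"
    unfolding \<psi>_def
    by (intro continuous_on_of_real continuous_on_compose2[of UNIV "apply_bcontfun u" K Re])
       (auto intro: continuous_intros)
  have restrict_C: "restrict f K \<in> C_alg K" if "continuous_on K f" for f
    using that by (simp add: C_alg_iff[OF K] cong: continuous_on_cong)
  have "\<phi> \<in> A_alg K" using restrict_C[OF cont] by (simp add: A \<phi>_def)
  moreover have "C_alg K \<subseteq> HP_space \<phi> K"
  proof
    fix f assume f: "f \<in> C_alg K"
    have P: "restrict (poly p) K \<in> P_alg K" for p
      unfolding P_alg_def
      by (rule subsetD[OF subset_C_closure]) (auto intro!: restrict_C continuous_intros)
    have R: "restrict (poly q) K \<in> R_alg K" for q
      unfolding R_alg_def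
    proof (rule subsetD[OF subset_C_closure])
      show "restrict (poly q) K \<in> {restrict (\<lambda>z. poly p z / poly q z) K |p q. q \<noteq> 0 \<and> (\<forall>z\<in>K. poly q z \<noteq> 0)}"
        by (rule CollectI, rule exI[of _ q], rule exI[of _ 1]) auto
    qed (auto intro!: restrict_C continuous_intros)
    have PC: "continuous_on K p" if "p \<in> P_alg K \<or> p \<in> R_alg K" for p
      using that C_closure_subset C_alg_iff[OF K] unfolding P_alg_def R_alg_def by blast
    have hp: "hp_limit K \<psi> f"
    proof (rule hp_limit_continuous[OF K])
      show "hp_limit K \<psi> (\<lambda>z. of_real (Re z) ^ m)" for m
        using u[of m] unfolding hp_limit_def \<psi>_def K_def by (meson DiffD1)
      show "continuous_on K f" using f C_alg_iff[OF K] by blast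
    qed
    show "f \<in> HP_space \<phi> K"
      unfolding HP_space_def
    proof (subst C_closure_iff[OF K], goal_cases)
      case 1
      show ?case
        using cont PC by (auto intro!: restrict_C continuous_intros simp: \<phi>_def cong: continuous_on_cong)
    next
      case 2
      show ?case
      proof (intro conjI f allI impI)
        fix e :: real assume "e > 0"
        then obtain p q where pq: "\<And>z. z \<in> K \<Longrightarrow> cmod (f z - (poly p z * \<psi> z + poly q z)) < e"
          using hp_limitD[OF hp] by blast
        show "\<exists>g\<in>{restrict (\<lambda>z. p z * \<phi> z + r z) K |p r. p \<in> P_alg K \<and> r \<in> R_alg K}.
            \<forall>z\<in>K. cmod (g z - f z) < e"
        proof (rule bexI)
          show "restrict (\<lambda>z. restrict (poly p) K z * \<phi> z + restrict (poly q) K z) K \<in>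
              {restrict (\<lambda>z. p z * \<phi> z + r z) K |p r. p \<in> P_alg K \<and> r \<in> R_alg K}"
            using P[of p] R[of q] by blast
          show "\<forall>z\<in>K. cmod (restrict (\<lambda>z. restrict (poly p) K z * \<phi> z + restrict (poly q) K z) K z - f z) < e"
            using pq by (simp add: \<phi>_def norm_minus_commute)
        qed
      qed
    qed
  qed
  moreover have "HP_space \<phi> K \<subseteq> C_alg K"
    unfolding HP_space_def by (rule C_closure_subset)
  moreover have "restrict cnj K \<notin> R_alg K"
  proof
    assume R: "restrict cnj K \<in> R_alg K"
    have sub: "{restrict (\<lambda>z. poly p z / poly q z) K |p q. q \<noteq> 0 \<and> (\<forall>z\<in>K. poly q z \<noteq> 0)} \<subseteq> C_alg K"
      by (auto intro!: restrict_C continuous_intros)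
    have "\<forall>e>0. \<exists>g\<in>{restrict (\<lambda>z. poly p z / poly q z) K |p q. q \<noteq> 0 \<and> (\<forall>z\<in>K. poly q z \<noteq> 0)}.
        \<forall>z\<in>K. cmod (g z - restrict cnj K z) < e"
      using R unfolding R_alg_def C_closure_iff[OF K sub] by blast
    \<comment> \<open>Any tolerance below \<open>1 / 2\<close> would contradict
      \<open>rational_far_from_cnj\<close>.\<close>
    then have "\<exists>g\<in>{restrict (\<lambda>z. poly p z / poly q z) K |p q. q \<noteq> 0 \<and> (\<forall>z\<in>K. poly q z \<noteq> 0)}.
        \<forall>z\<in>K. cmod (g z - restrict cnj K z) < 1 / 4"
      by (rule allE[where x = "1 / 4"]) simp
    then obtain p q where q: "q \<noteq> 0" "\<forall>z\<in>K. poly q z \<noteq> 0"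
      and "\<forall>z\<in>K. cmod (restrict (\<lambda>z. poly p z / poly q z) K z - restrict cnj K z) < 1 / 4"
      by blast
    then have pq: "cmod (poly p z / poly q z - cnj z) < 1 / 4" if "z \<in> K" for z
      using that by force
    define Z where "Z = {z \<in> cball 0 1. poly q z = 0}"
    have "finite Z" using poly_roots_finite[OF q(1)] by (simp add: Z_def)
    moreover have "Z \<subseteq> (\<Union>n. V n)" using q(2) by (auto simp: Z_def K_def)
    ultimately obtain n where n: "Z \<subseteq> V n"
      using finite_subset_incseq[OF _ V] by metis
    have "(1 / 4 :: real) \<ge> 1 / 2"
    proof (rule rational_far_from_cnj[OF F(1,3) q(1)])
      show "z \<in> (\<Union>(a, r)\<in>F n. ball a r)" if "z \<in> cball 0 1" "poly q z = 0" for z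
        using n that by (auto simp: Z_def V_def)
      show "cmod (poly p z / poly q z - cnj z) \<le> 1 / 4"
        if z: "z \<in> sphere 0 1 \<union> (\<Union>(a, r)\<in>F n. sphere a r)" for z
      proof -
        \<comment> \<open>Stage \<open>n\<close> alone shows only that its circles avoid its own
          discs. Seen in the larger family of stage \<open>max m n\<close>, they avoid the discs of
          stage \<open>m\<close> as well.\<close>
        have "z \<in> cball 0 1 - V m" for m
        proof -
          define k where "k = max m n"
          have sub: "V m \<subseteq> V k" "F n \<subseteq> F k"
            using V F(2) by (simp_all add: incseq_def k_def)
          have "sphere 0 1 \<union> (\<Union>(a, r)\<in>F n. sphere a r) \<subseteq> cball 0 1 - V k"
            unfolding V_def
            using sub(2) disc_family_sphere[OF F(1)[of k]] disc_family_unit_sphere[OF F(1)[of k]] by blast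
          then show ?thesis using z sub(1) by blast
        qed
        then have "z \<in> K" by (auto simp: K_def)
        then show ?thesis using pq by (simp add: less_imp_le)
      qed
    qed simp
    then show False by simp
  qed
  then have "R_alg K \<noteq> A_alg K"
    using restrict_C[of cnj] by (auto simp: A intro: continuous_intros)
  ultimately show ?thesis
    using K A by blast
qed

end
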